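(* For every polynomial $P$ on $\mathbb C$ (in one complex variable, with complex coefficients), its graph $$\mathcal C=\big\{(z,\zeta)\in\mathbb C^2: \zeta=P(z)\big\}$$ is a uniformly flat algebraic curve in $\mathbb C^2$, and its upper density with respect to the Gaussian weight $|\cdot|^2$ vanishes, i.e. $D_{|\cdot|^2}(\mathcal C)=0$.
   Context: Uniform flatness. A smooth analytic hypersurface $W\subset\mathbb C^n$ is said to be uniformly flat if there exists a constant $\varepsilon>0$ such that $N_\varepsilon(W):=\{z\in\mathbb C^n:\mathrm{dist}(z,W)<\varepsilon\}$ (Euclidean distance) forms a tubular neighborhood of $W$ in $\mathbb C^n$. Explicitly, write $W=T^{-1}(0)$, where $T$ is an entire function on $\mathbb C^n$ with $\mathrm dT$ nowhere vanishing on $W$ (such $T$ always exists; for $\mathcal C$ one can take $T(z,\zeta)=\zeta-P(z)$). Then uniform flatness of $W$ means that there is a constant $\varepsilon>0$ such that the map $$W\times\Delta(0,\varepsilon)\to N_\varepsilon(W),\qquad (z,t)\mapsto z+t\,\frac{\overline{\mathrm{grad}\,T(z)}}{|\mathrm{grad}\,T(z)|}$$ is a diffeomorphism, where $\Delta(0,\varepsilon)\subset\mathbb C$ is the open disc of radius $\varepsilon$ centered at $0$ and $\mathrm{grad}\,T=(\partial T/\partial z_1,\dots,\partial T/\partial z_n)$ is the complex gradient. Upper density. Let $B(z,r)$ be the Euclidean ball in $\mathbb C^n$ with center $z$ and radius $r$. For an analytic hypersurface $W\subset\mathbb C^n$ with current of integration $[W]$, and for $r>0$, define the $(1,1)$-current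 $$\Upsilon_r^W:=[W]*\frac{\mathbf 1_{B(0,r)}}{\mathrm{Vol}(B(0,r))},$$ where $\mathbf 1_E$ is the characteristic function of $E$ and $*$ is convolution (so $\Upsilon_r^W(z)$ is the average of $[W]$ over $B(z,r)$). For a plurisubharmonic function $\varphi$ on $\mathbb C^n$ set $\varphi_r:=\varphi*\frac{\mathbf 1_{B(0,r)}}{\mathrm{Vol}(B(0,r))}$. The upper density of $W$ with respect to $\varphi$ is $$D_\varphi(W):=\inf\Big\{\alpha\in(0,\infty]:\ \frac{\sqrt{-1}}{2\pi}\partial\overline\partial\varphi_r-\frac1\alpha\Upsilon_r^W\ge0\ \text{ for all sufficiently large } r\Big\},$$ where $\ge 0$ means positivity in the sense of $(1,1)$-currents. Here $n=2$ and $\varphi=|\cdot|^2$ is the squared Euclidean norm on $\mathbb C^2$. *)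

theory Defs
  imports "HOL-Analysis.Analysis" "HOL-Computational_Algebra.Polynomial"
begin

section \<open>Smooth maps and diffeomorphisms\<close>

text \<open>Only used for open \<open>S\<close> in a finite-dimensional space; there, differentiability together with
  \<open>C^k\<close> directional derivatives is the same as being \<open>C^(k+1)\<close>.\<close>

primrec Ck_on :: "nat \<Rightarrow> 'a::real_normed_vector set \<Rightarrow> ('a \<Rightarrow> 'b::real_normed_vector) \<Rightarrow> bool" where
  "Ck_on 0 S f \<longleftrightarrow> continuous_on S f"
| "Ck_on (Suc k) S f \<longleftrightarrow>
     (\<forall>x\<in>S. f differentiable (at x)) \<and> (\<forall>v. Ck_on k S (\<lambda>x. frechet_derivative f (at x) v))"

definition smooth_on_open :: "'a::real_normed_vector set \<Rightarrow> ('a \<Rightarrow> 'b::real_normed_vector) \<Rightarrow> bool" where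
  "smooth_on_open S f \<longleftrightarrow> open S \<and> (\<forall>k. Ck_on k S f)"

text \<open>Smoothness on an arbitrary subset (such as a submanifold) of a Euclidean space: local
  extendability to a smooth map on an ambient open set.\<close>

definition smooth_map_on :: "'a::real_normed_vector set \<Rightarrow> ('a \<Rightarrow> 'b::real_normed_vector) \<Rightarrow> bool" where
  "smooth_map_on A f \<longleftrightarrow>
     (\<forall>x\<in>A. \<exists>U F. x \<in> U \<and> smooth_on_open U F \<and> (\<forall>y\<in>A \<inter> U. F y = f y))"

definition diffeomorphism_between ::
  "'a::real_normed_vector set \<Rightarrow> 'b::real_normed_vector set \<Rightarrow> ('a \<Rightarrow> 'b) \<Rightarrow> bool" where
  "diffeomorphism_between A B f \<longleftrightarrow>
     bij_betw f A B \<and> smooth_map_on A f \<and> smooth_map_on B (inv_into A f)"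


section \<open>Uniformly flat hypersurfaces\<close>

definition d_z :: "'n::finite \<Rightarrow> (complex ^ 'n \<Rightarrow> complex) \<Rightarrow> complex ^ 'n \<Rightarrow> complex" where
  "d_z j f p = (frechet_derivative f (at p) (axis j 1)
                - \<i> * frechet_derivative f (at p) (axis j \<i>)) / 2"

definition d_zbar :: "'n::finite \<Rightarrow> (complex ^ 'n \<Rightarrow> complex) \<Rightarrow> complex ^ 'n \<Rightarrow> complex" where
  "d_zbar j f p = (frechet_derivative f (at p) (axis j 1)
                   + \<i> * frechet_derivative f (at p) (axis j \<i>)) / 2"

definition entire :: "(complex ^ 'n::finite \<Rightarrow> complex) \<Rightarrow> bool" where
  "entire T \<longleftrightarrow>
     (\<forall>p. \<exists>L. (T has_derivative L) (at p) \<and> (\<forall>c v. L (c *s v) = c * L v))"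

definition cgrad :: "(complex ^ 'n::finite \<Rightarrow> complex) \<Rightarrow> complex ^ 'n \<Rightarrow> complex ^ 'n" where
  "cgrad T p = (\<chi> j. d_z j T p)"

definition defining_function :: "(complex ^ 'n::finite \<Rightarrow> complex) \<Rightarrow> (complex ^ 'n) set \<Rightarrow> bool" where
  "defining_function T W \<longleftrightarrow>
     entire T \<and> W = {p. T p = 0} \<and> (\<forall>p\<in>W. cgrad T p \<noteq> 0)"

text \<open>Written as a union of balls rather than with \<^const>\<open>infdist\<close>, because \<^const>\<open>infdist\<close> to the
  empty set is \<open>0\<close>.\<close>

definition nbhd :: "real \<Rightarrow> (complex ^ 'n::finite) set \<Rightarrow> (complex ^ 'n) set" where
  "nbhd \<epsilon> W = (\<Union>w\<in>W. ball w \<epsilon>)"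

definition normal_map :: "(complex ^ 'n::finite \<Rightarrow> complex) \<Rightarrow> (complex ^ 'n) \<times> complex \<Rightarrow> complex ^ 'n" where
  "normal_map T = (\<lambda>(p, t). p + t *s ((1 / norm (cgrad T p)) *\<^sub>R (\<chi> j. cnj (cgrad T p $ j))))"

text \<open>Two defining functions of \<open>W\<close> give normal maps differing by a smooth unimodular factor on \<open>t\<close>,
  so the choice of \<open>T\<close> is immaterial.\<close>

definition uniformly_flat :: "(complex ^ 'n::finite) set \<Rightarrow> bool" where
  "uniformly_flat W \<longleftrightarrow>
     (\<exists>T. defining_function T W \<and>
        (\<exists>\<epsilon>>0. diffeomorphism_between (W \<times> ball 0 \<epsilon>) (nbhd \<epsilon> W) (normal_map T)))"


section \<open>Currents of bidegree (1,1) on two-dimensional complex space\<close>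

text \<open>A matrix-valued function \<open>\<beta>\<close> stands for the (1,1)-form
  \<open>\<i> (\<Sum>j k. \<beta>$j$k dz_j \<and> dzbar_k)\<close>. As the complex dimension is two, currents of
  bidegree (1,1) act on test forms of bidegree (1,1).\<close>

type_synonym form11 = "complex ^ 2 \<Rightarrow> complex ^ 2 ^ 2"
type_synonym current11 = "form11 \<Rightarrow> complex"

definition test_form :: "form11 \<Rightarrow> bool" where
  "test_form \<beta> \<longleftrightarrow> smooth_on_open UNIV \<beta> \<and> compact (closure {p. \<beta> p \<noteq> 0})"

text \<open>In this bidegree the weak and strong notions of positivity of forms coincide.\<close>

definition positive_form :: "form11 \<Rightarrow> bool" where
  "positive_form \<beta> \<longleftrightarrow>
     (\<forall>p u. (\<Sum>j\<in>UNIV. \<Sum>k\<in>UNIV. \<beta> p $ j $ k * u $ j * cnj (u $ k)) \<in> \<real>\<^sub>\<ge>\<^sub>0)"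

definition positive_current :: "current11 \<Rightarrow> bool" where
  "positive_current \<Theta> \<longleftrightarrow>
     (\<forall>\<beta>. test_form \<beta> \<and> positive_form \<beta> \<longrightarrow> \<Theta> \<beta> \<in> \<real>\<^sub>\<ge>\<^sub>0)"

text \<open>The current \<open>\<i> \<partial>\<partial>bar \<phi>\<close> in the distributional sense, \<open>\<beta> \<mapsto> \<integral> \<phi> \<i> \<partial>\<partial>bar \<beta>\<close>. The signs come from
  expanding the wedge product and the factor 4 from
  \<open>(\<i> dz_1 \<and> dzbar_1) \<and> (\<i> dz_2 \<and> dzbar_2) = 4 dV\<close> with \<open>dV\<close> the Lebesgue measure.\<close>

definition i_ddbar :: "(complex ^ 2 \<Rightarrow> real) \<Rightarrow> current11" where
  "i_ddbar \<phi> \<beta> =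
     (LINT p|lborel. complex_of_real (\<phi> p) * (4 *
        (d_z 1 (d_zbar 1 (\<lambda>q. \<beta> q $ 2 $ 2)) p + d_z 2 (d_zbar 2 (\<lambda>q. \<beta> q $ 1 $ 1)) p
         - d_z 1 (d_zbar 2 (\<lambda>q. \<beta> q $ 2 $ 1)) p - d_z 2 (d_zbar 1 (\<lambda>q. \<beta> q $ 1 $ 2)) p)))"


section \<open>The current of integration over a smooth analytic curve\<close>

definition local_parametrization ::
  "(complex ^ 2) set \<Rightarrow> complex set \<Rightarrow> (complex \<Rightarrow> complex ^ 2) \<Rightarrow> bool" where
  "local_parametrization W U \<gamma> \<longleftrightarrow>
     open U \<and> (\<forall>j. (\<lambda>w. \<gamma> w $ j) holomorphic_on U) \<and>
     (\<forall>w\<in>U. \<exists>j. deriv (\<lambda>w. \<gamma> w $ j) w \<noteq> 0) \<and>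
     openin (top_of_set W) (\<gamma> ` U) \<and> (\<exists>\<delta>. homeomorphism U (\<gamma> ` U) \<gamma> \<delta>)"

text \<open>The integral over \<open>U\<close> of the pullback \<open>\<gamma>\<^sup>* \<beta>\<close>; the factor 2 comes from
  \<open>\<i> dw \<and> dwbar = 2 dA\<close> with \<open>dA\<close> the Lebesgue measure on the complex plane.\<close>

definition pullback_integral :: "complex set \<Rightarrow> (complex \<Rightarrow> complex ^ 2) \<Rightarrow> form11 \<Rightarrow> complex" where
  "pullback_integral U \<gamma> \<beta> =
     (LINT w:U|lborel. 2 * (\<Sum>j\<in>UNIV. \<Sum>k\<in>UNIV.
        \<beta> (\<gamma> w) $ j $ k * deriv (\<lambda>w. \<gamma> w $ j) w * cnj (deriv (\<lambda>w. \<gamma> w $ k) w)))"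

text \<open>\<open>I\<close> is the integral of \<open>\<beta>\<close> over the complex curve \<open>W\<close>, computed with local parametrizations
  and a subordinate finite partition of unity on \<open>W\<close> near the support of \<open>\<beta>\<close>.\<close>

definition has_form_integral :: "(complex ^ 2) set \<Rightarrow> form11 \<Rightarrow> complex \<Rightarrow> bool" where
  "has_form_integral W \<beta> I \<longleftrightarrow>
     (\<exists>(N::nat) U \<gamma> (\<rho>::nat \<Rightarrow> complex ^ 2 \<Rightarrow> real).
        (\<forall>i<N. local_parametrization W (U i) (\<gamma> i) \<and>
               smooth_on_open UNIV (\<rho> i) \<and> (\<forall>p. 0 \<le> \<rho> i p) \<and>
               (\<exists>K. compact K \<and> K \<subseteq> \<gamma> i ` U i \<and> (\<forall>p\<in>W - K. \<rho> i p *\<^sub>R \<beta> p = 0))) \<and>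
        (\<forall>p \<in> W \<inter> closure {p. \<beta> p \<noteq> 0}. (\<Sum>i<N. \<rho> i p) = 1) \<and>
        I = (\<Sum>i<N. pullback_integral (U i) (\<gamma> i) (\<lambda>p. \<rho> i p *\<^sub>R \<beta> p)))"

text \<open>For a closed complex submanifold \<open>W\<close> of dimension one and a test form \<open>\<beta>\<close>, the integral exists
  and does not depend on the choices.\<close>

definition integration_current :: "(complex ^ 2) set \<Rightarrow> current11" where
  "integration_current W \<beta> = (THE I. has_form_integral W \<beta> I)"


section \<open>Ball averages and upper density\<close>

definition ball_kernel :: "real \<Rightarrow> complex ^ 'n::finite \<Rightarrow> real" where
  "ball_kernel r w = indicator (ball 0 r) w / measure lborel (ball (0 :: complex ^ 'n) r)"

definition convolve_fun ::
  "(complex ^ 'n::finite \<Rightarrow> real) \<Rightarrow> (complex ^ 'n \<Rightarrow> real) \<Rightarrow> complex ^ 'n \<Rightarrow> real" where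
  "convolve_fun f g z = (LINT w|lborel. f (z - w) * g w)"

text \<open>By duality: the convolution with \<open>g\<close> applied to \<open>\<beta>\<close> is the current applied to the convolution
  of \<open>\<beta>\<close> with the reflected kernel \<open>w \<mapsto> g (- w)\<close>.\<close>

definition convolve_current :: "current11 \<Rightarrow> (complex ^ 2 \<Rightarrow> real) \<Rightarrow> current11" where
  "convolve_current \<Theta> g \<beta> = \<Theta> (\<lambda>z. LINT w|lborel. g w *\<^sub>R \<beta> (z + w))"

text \<open>The weight \<open>\<phi>\<close> is real-valued: the set where a plurisubharmonic function is \<open>-\<infinity>\<close> is a null set,
  so its values there do not matter. For \<open>\<alpha> = \<infinity>\<close> the coefficient \<open>1 / \<alpha>\<close> is \<open>0\<close>.\<close>

definition upper_density :: "(complex ^ 2 \<Rightarrow> real) \<Rightarrow> (complex ^ 2) set \<Rightarrow> ereal" where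
  "upper_density \<phi> W = Inf {\<alpha>. 0 < \<alpha> \<and>
     (\<forall>\<^sub>F r in at_top. positive_current (\<lambda>\<beta>.
        complex_of_real (1 / (2 * pi)) * i_ddbar (convolve_fun \<phi> (ball_kernel r)) \<beta>
        - complex_of_real (real_of_ereal (1 / \<alpha>))
          * convolve_current (integration_current W) (ball_kernel r) \<beta>))}"


section \<open>Algebraic curves and graphs of polynomials\<close>

text \<open>A bivariate polynomial is a polynomial in the second variable whose coefficients are
  polynomials in the first.\<close>

definition algebraic_curve :: "(complex ^ 2) set \<Rightarrow> bool" where
  "algebraic_curve W \<longleftrightarrow>
     (\<exists>Q :: complex poly poly. (\<nexists>c. Q = [:[:c:]:]) \<and>
        W = {p. poly (poly Q [:p $ 2:]) (p $ 1) = 0})"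

definition poly_graph :: "complex poly \<Rightarrow> (complex ^ 2) set" where
  "poly_graph P = {p. p $ 2 = poly P (p $ 1)}"

end

theory Submission
  imports Defs "HOL-Complex_Analysis.Cauchy_Integral_Formula"
begin

text \<open>
  Let \<open>W\<close> be the graph of \<open>P\<close>, parametrized by \<open>z \<mapsto> (z, P z)\<close>.

  Uniform flatness rests on one estimate (\<open>poly_tangent_deviation\<close>): a chord of \<open>W\<close> of length \<open>l\<close> leaves
  the tangent line at its starting point by at most \<open>C l\<^sup>2\<close>, with the same \<open>C\<close> at all points. It holds because
  the degree of \<open>P''\<close> does not exceed that of \<open>P'\<close>, so that \<open>P''\<close> is dominated by the length of the normal vector
  \<open>(- cnj P', 1)\<close>. This is Federer's criterion for
  positive reach: two points of the normal discs of radius below \<open>1 / (2 C)\<close> cannot be much closer to each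
  other than their feet (\<open>foot_Lipschitz\<close>), hence the normal map is injective, and it is onto the tube because a
  nearest point of \<open>W\<close> is a foot (\<open>tube_point_surj\<close>). The foot is thus a Lipschitz function on the tube. Its
  derivative is an explicit smooth expression in the foot itself (\<open>has_derivative_foot\<close>), and smoothness of all
  orders follows by induction.

  For the density, averaging changes the Gaussian weight only by an affine function, so the form
  \<open>\<i>/(2 \<pi>) \<partial>\<partial>bar \<phi>\<^sub>r\<close> sends a test form \<open>\<beta>\<close> to \<open>2/\<pi>\<close> times the integral of its trace, for every \<open>r\<close>
  (\<open>i_ddbar_convolve_norm_sq\<close>). For positive \<open>\<beta>\<close> the averaged current of \<open>W\<close> gives at most twice the integral
  of the trace, times the largest area of \<open>W\<close> in a ball of radius \<open>r\<close>, divided by the volume of the ball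
  (\<open>averaged_graph_current_bound\<close>). The volume grows like \<open>r\<^sup>4\<close>, but the area is \<open>O(r\<^sup>2)\<close> uniformly in the centre
  (\<open>graph_area_bound\<close>), because \<open>W\<close> covers discs in the two coordinate axes at most \<open>1\<close> and \<open>deg P\<close> times. Hence
  every \<open>\<alpha> > 0\<close> is admissible in the definition of the upper density.

  The bound on the multiplicity of \<open>P\<close> is proved in integrated form: the integral of \<open>\<bar>P'\<bar>\<^sup>2\<close> against a
  bump around \<open>c\<close>, pulled back by \<open>P\<close>, does not depend on \<open>c\<close>, since its derivative in \<open>c\<close> is the integral of a
  divergence (\<open>smoothed_area_constant\<close>). For \<open>c = 0\<close> it is estimated by the growth of \<open>P\<close>.
\<close>

section \<open>Calculus of \<open>C^k\<close> maps\<close>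

lemma Ck_on_cong:
  assumes "open S" "\<And>x. x \<in> S \<Longrightarrow> f x = g x"
  shows "Ck_on k S f \<longleftrightarrow> Ck_on k S g"
proof -
  have *: "Ck_on k S f \<Longrightarrow> Ck_on k S g" if "\<And>x. x \<in> S \<Longrightarrow> f x = g x" for f g :: "'a \<Rightarrow> 'b" and k
    using that
  proof (induction k arbitrary: f g)
    case 0
    then show ?case using continuous_on_cong[of S S f g] by simp
  next
    case (Suc k)
    have d: "(g has_derivative frechet_derivative f (at x)) (at x)" if "x \<in> S" for x
    proof (rule has_derivative_transform_within_open[OF _ assms(1) that])
      show "(f has_derivative frechet_derivative f (at x)) (at x)"
        using Suc.prems(1) that by (simp add: frechet_derivative_works)
    qed (use Suc.prems in auto)
    have "frechet_derivative g (at x) = frechet_derivative f (at x)" if "x \<in> S" for x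
      using frechet_derivative_at[OF d[OF that]] by simp
    then have "Ck_on k S (\<lambda>x. frechet_derivative g (at x) v)" for v
      using Suc.prems(1) by (subst Suc.IH[of "\<lambda>x. frechet_derivative f (at x) v"]) auto
    then show ?case
      using d by (auto simp: differentiable_def)
  qed
  show ?thesis using *[of f g] *[of g f] assms by auto
qed

text \<open>The proofs below raise the order of smoothness by one at a time: it suffices to exhibit some derivative
  whose values on fixed vectors are \<open>C^k\<close>.\<close>

lemma Ck_on_SucI:
  assumes "open S" "\<And>x. x \<in> S \<Longrightarrow> (f has_derivative f' x) (at x)"
    and "\<And>v. Ck_on k S (\<lambda>x. f' x v)"
  shows "Ck_on (Suc k) S f"
proof -
  have "frechet_derivative f (at x) = f' x" if "x \<in> S" for x
    using frechet_derivative_at[OF assms(2)[OF that]] by simp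
  then have "Ck_on k S (\<lambda>x. frechet_derivative f (at x) v)" for v
    using assms(3)[of v] by (subst Ck_on_cong[OF assms(1)]) auto
  then show ?thesis using assms(2) by (auto simp: differentiable_def)
qed

lemma Ck_on_SucE:
  assumes "Ck_on (Suc k) S f"
  obtains f' where "\<And>x. x \<in> S \<Longrightarrow> (f has_derivative f' x) (at x)"
    and "\<And>v. Ck_on k S (\<lambda>x. f' x v)"
proof (rule that)
  show "(f has_derivative frechet_derivative f (at x)) (at x)" if "x \<in> S" for x
    using assms that by (simp add: frechet_derivative_works)
  show "Ck_on k S (\<lambda>x. frechet_derivative f (at x) v)" for v
    using assms by simp
qed

lemma Ck_on_Suc_imp: "Ck_on (Suc k) S f \<Longrightarrow> Ck_on k S f"
proof (induction k arbitrary: f)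
  case 0
  then show ?case
    by (auto intro!: differentiable_imp_continuous_on
        simp: differentiable_on_def differentiable_at_withinI)
next
  case (Suc k)
  have "\<forall>x\<in>S. f differentiable at x" "Ck_on (Suc k) S (\<lambda>x. frechet_derivative f (at x) v)" for v
    using Suc.prems unfolding Ck_on.simps(2)[of "Suc k"] by blast+
  then show ?case
    using Suc.IH by (simp only: Ck_on.simps(2)[of k]) simp
qed

lemma Ck_on_imp_continuous_on: "Ck_on k S f \<Longrightarrow> continuous_on S f"
proof (induction k)
  case (Suc k)
  then show ?case using Ck_on_Suc_imp by blast
qed simp

lemma Ck_on_const [simp]: "open S \<Longrightarrow> Ck_on k S (\<lambda>x. c)"
proof (induction k arbitrary: c)
  case (Suc k)
  show ?case by (rule Ck_on_SucI[where f' = "\<lambda>x v. 0"]) (use Suc in auto)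
qed simp

lemma Ck_on_bounded_linear:
  assumes "open S" "bounded_linear L"
  shows "Ck_on k S L"
proof (cases k)
  case 0
  then show ?thesis using assms by (simp add: linear_continuous_on)
next
  case (Suc j)
  show ?thesis unfolding Suc using assms
    by (intro Ck_on_SucI[where f' = "\<lambda>x. L"] bounded_linear_imp_has_derivative Ck_on_const)
qed

lemma Ck_on_linear_comp:
  assumes "open S" "bounded_linear L"
  shows "Ck_on k S f \<Longrightarrow> Ck_on k S (\<lambda>x. L (f x))"
proof (induction k arbitrary: f)
  case 0
  then show ?case using assms(2) by (simp add: bounded_linear.continuous_on)
next
  case (Suc k)
  then obtain f' where "\<And>x. x \<in> S \<Longrightarrow> (f has_derivative f' x) (at x)" "\<And>v. Ck_on k S (\<lambda>x. f' x v)"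
    using Ck_on_SucE by blast
  then show ?case
    by (intro Ck_on_SucI[where f' = "\<lambda>x v. L (f' x v)"] bounded_linear.has_derivative[OF assms(2)] Suc.IH assms)
qed

lemma Ck_on_add:
  assumes "open S"
  shows "Ck_on k S f \<Longrightarrow> Ck_on k S g \<Longrightarrow> Ck_on k S (\<lambda>x. f x + g x)"
proof (induction k arbitrary: f g)
  case 0
  then show ?case by (simp add: continuous_on_add)
next
  case (Suc k)
  obtain f' where "\<And>x. x \<in> S \<Longrightarrow> (f has_derivative f' x) (at x)" "\<And>v. Ck_on k S (\<lambda>x. f' x v)"
    using Ck_on_SucE Suc.prems(1) by blast
  moreover obtain g' where "\<And>x. x \<in> S \<Longrightarrow> (g has_derivative g' x) (at x)" "\<And>v. Ck_on k S (\<lambda>x. g' x v)"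
    using Ck_on_SucE Suc.prems(2) by blast
  ultimately show ?case
    by (intro Ck_on_SucI[where f' = "\<lambda>x v. f' x v + g' x v"] has_derivative_add Suc.IH assms)
qed

lemma Ck_on_bilinear:
  assumes "open S" "bounded_bilinear B"
  shows "Ck_on k S f \<Longrightarrow> Ck_on k S g \<Longrightarrow> Ck_on k S (\<lambda>x. B (f x) (g x))"
proof (induction k arbitrary: f g)
  case 0
  then show ?case using assms(2) by (simp add: bounded_bilinear.continuous_on)
next
  case (Suc k)
  obtain f' where f': "\<And>x. x \<in> S \<Longrightarrow> (f has_derivative f' x) (at x)" "\<And>v. Ck_on k S (\<lambda>x. f' x v)"
    using Ck_on_SucE Suc.prems(1) by blast
  obtain g' where g': "\<And>x. x \<in> S \<Longrightarrow> (g has_derivative g' x) (at x)" "\<And>v. Ck_on k S (\<lambda>x. g' x v)"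
    using Ck_on_SucE Suc.prems(2) by blast
  show ?case
  proof (rule Ck_on_SucI[OF assms(1)])
    show "((\<lambda>x. B (f x) (g x)) has_derivative (\<lambda>v. B (f x) (g' x v) + B (f' x v) (g x))) (at x)"
      if "x \<in> S" for x
      by (rule bounded_bilinear.FDERIV[OF assms(2) f'(1)[OF that] g'(1)[OF that]])
    show "Ck_on k S (\<lambda>x. B (f x) (g' x v) + B (f' x v) (g x))" for v
      by (intro Ck_on_add assms Suc.IH Ck_on_Suc_imp[OF Suc.prems(1)] Ck_on_Suc_imp[OF Suc.prems(2)] f' g')
  qed
qed

lemmas Ck_on_mult = Ck_on_bilinear[OF _ bounded_bilinear_mult]
lemmas Ck_on_scaleR = Ck_on_bilinear[OF _ bounded_bilinear_scaleR]
lemmas Ck_on_cnj = Ck_on_linear_comp[OF _ bounded_linear_cnj]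
lemmas Ck_on_of_real = Ck_on_linear_comp[OF _ bounded_linear_of_real]
lemmas Ck_on_Re = Ck_on_linear_comp[OF _ bounded_linear_Re]
lemmas Ck_on_fst = Ck_on_linear_comp[OF _ bounded_linear_fst]
lemmas Ck_on_snd = Ck_on_linear_comp[OF _ bounded_linear_snd]
lemmas Ck_on_nth = Ck_on_linear_comp[OF _ bounded_linear_vec_nth]

lemma Ck_on_minus: "open S \<Longrightarrow> Ck_on k S f \<Longrightarrow> Ck_on k S (\<lambda>x. - f x)"
  by (rule Ck_on_linear_comp[of S uminus]) (auto intro: bounded_linear_minus bounded_linear_ident)

lemma Ck_on_diff:
  assumes "open S" "Ck_on k S f" "Ck_on k S g"
  shows "Ck_on k S (\<lambda>x. f x - g x)"
  using Ck_on_add[OF assms(1,2) Ck_on_minus[OF assms(1,3)]] by simp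

lemma Ck_on_Pair:
  assumes "open S" "Ck_on k S f" "Ck_on k S g"
  shows "Ck_on k S (\<lambda>x. (f x, g x))"
proof -
  have "Ck_on k S (\<lambda>x. (f x, 0) + (0, g x))"
    by (intro Ck_on_add assms Ck_on_linear_comp[where L = "\<lambda>y. (y, 0)"]
        Ck_on_linear_comp[where L = "\<lambda>y. (0, y)"] bounded_linear_Pair
        bounded_linear_ident bounded_linear_zero)
  then show ?thesis by simp
qed

text \<open>The derivatives of the inverse and of the square root are products involving the function itself, so that
  the induction hypothesis applies to them.\<close>

lemma Ck_on_inverse:
  fixes f :: "'a::real_normed_vector \<Rightarrow> real"
  assumes "open S" "\<And>x. x \<in> S \<Longrightarrow> f x \<noteq> 0"
  shows "Ck_on k S f \<Longrightarrow> Ck_on k S (\<lambda>x. inverse (f x))"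
proof (induction k)
  case 0
  then show ?case using assms by (auto intro!: continuous_on_inverse)
next
  case (Suc k)
  obtain f' where f': "\<And>x. x \<in> S \<Longrightarrow> (f has_derivative f' x) (at x)" "\<And>v. Ck_on k S (\<lambda>x. f' x v)"
    using Ck_on_SucE Suc.prems(1) by blast
  show ?case
  proof (rule Ck_on_SucI[OF assms(1)])
    show "((\<lambda>x. inverse (f x)) has_derivative (\<lambda>v. - (inverse (f x) * f' x v * inverse (f x)))) (at x)"
      if "x \<in> S" for x
      by (rule Deriv.has_derivative_inverse[OF assms(2)[OF that] f'(1)[OF that]])
    show "Ck_on k S (\<lambda>x. - (inverse (f x) * f' x v * inverse (f x)))" for v
      by (intro Ck_on_minus Ck_on_mult assms f' Suc.IH Ck_on_Suc_imp[OF Suc.prems(1)])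
  qed
qed

lemma Ck_on_sqrt:
  fixes f :: "'a::real_normed_vector \<Rightarrow> real"
  assumes "open S" "\<And>x. x \<in> S \<Longrightarrow> f x > 0"
  shows "Ck_on k S f \<Longrightarrow> Ck_on k S (\<lambda>x. sqrt (f x))"
proof (induction k)
  case 0
  then show ?case by (auto intro!: continuous_on_real_sqrt)
next
  case (Suc k)
  obtain f' where f': "\<And>x. x \<in> S \<Longrightarrow> (f has_derivative f' x) (at x)" "\<And>v. Ck_on k S (\<lambda>x. f' x v)"
    using Ck_on_SucE Suc.prems(1) by blast
  show ?case
  proof (rule Ck_on_SucI[OF assms(1)])
    show "((\<lambda>x. sqrt (f x)) has_derivative (\<lambda>v. f' x v * ((1/2) * inverse (sqrt (f x))))) (at x)"
      if "x \<in> S" for x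
      using f'(1)[OF that] assms(2)[OF that]
      by (auto intro!: derivative_eq_intros simp: field_simps)
    have "sqrt (f x) \<noteq> 0" if "x \<in> S" for x using assms(2)[OF that] by simp
    then show "Ck_on k S (\<lambda>x. f' x v * ((1/2) * inverse (sqrt (f x))))" for v
      by (intro Ck_on_mult assms f' Ck_on_inverse Suc.IH Ck_on_Suc_imp[OF Suc.prems(1)] Ck_on_const) auto
  qed
qed

lemma Ck_on_poly:
  fixes f :: "'a::real_normed_vector \<Rightarrow> complex"
  assumes "open S" "Ck_on k S f"
  shows "Ck_on k S (\<lambda>x. poly P (f x))"
proof (induction P)
  case 0
  then show ?case using assms by simp
next
  case (pCons a P)
  then show ?case using assms by (auto intro!: Ck_on_add Ck_on_mult)
qed

section \<open>Growth of polynomials\<close>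

lemma poly_norm_le_power:
  fixes P :: "complex poly"
  assumes "degree P \<le> n"
  shows "\<exists>K>0. \<forall>z. norm (poly P z) \<le> K * (1 + norm z) ^ n"
proof -
  define K where "K = 1 + (\<Sum>i\<le>degree P. norm (coeff P i))"
  have "norm (poly P z) \<le> K * (1 + norm z) ^ n" for z
  proof -
    have "norm (poly P z) \<le> (\<Sum>i\<le>degree P. norm (coeff P i * z ^ i))"
      unfolding poly_altdef by (rule norm_sum)
    also have "\<dots> \<le> (\<Sum>i\<le>degree P. norm (coeff P i) * (1 + norm z) ^ n)"
    proof (rule sum_mono)
      fix i assume "i \<in> {..degree P}"
      then have "norm z ^ i \<le> (1 + norm z) ^ i" "(1 + norm z) ^ i \<le> (1 + norm z) ^ n"
        using assms by (auto intro: power_mono power_increasing)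
      then show "norm (coeff P i * z ^ i) \<le> norm (coeff P i) * (1 + norm z) ^ n"
        by (auto simp: norm_mult norm_power intro!: mult_left_mono)
    qed
    also have "\<dots> = (K - 1) * (1 + norm z) ^ n" by (simp add: K_def sum_distrib_right)
    also have "\<dots> \<le> K * (1 + norm z) ^ n" by (intro mult_right_mono) auto
    finally show ?thesis .
  qed
  moreover have "K > 0" unfolding K_def by (intro add_pos_nonneg sum_nonneg) auto
  ultimately show ?thesis by blast
qed

text \<open>For large \<open>z\<close> the leading term is at least twice the remaining ones, even after \<open>\<bar>z\<bar> ^ d\<close> has been
  compared with \<open>(1 + \<bar>z\<bar>) ^ d\<close> by Bernoulli's inequality; for bounded \<open>z\<close> a constant does.\<close>

lemma power_le_poly_norm:
  fixes P :: "complex poly"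
  assumes "P \<noteq> 0"
  shows "\<exists>K>0. \<forall>z. (1 + norm z) ^ degree P \<le> K * (1 + norm (poly P z))"
proof (cases "degree P")
  case 0
  then show ?thesis by (intro exI[of _ 1]) auto
next
  case (Suc m)
  define a where "a = norm (lead_coeff P)"
  have a: "a > 0" using assms by (simp add: a_def)
  define R where "R = P - monom (lead_coeff P) (degree P)"
  have "degree R \<le> m"
  proof (rule degree_le, intro allI impI)
    fix i assume "m < i"
    then show "coeff R i = 0" 
      by (cases "i = degree P") (use Suc in \<open>auto simp: R_def coeff_eq_0\<close>)
  qed
  then obtain K0 where K0: "K0 > 0" "\<And>z. norm (poly R z) \<le> K0 * (1 + norm z) ^ m"
    using poly_norm_le_power by blast
  \<comment> \<open>Beyond \<open>L\<close> half of the leading term absorbs the error \<open>K0\<close> from \<open>R\<close> and \<open>a (m + 1)\<close> from Bernoulli.\<close>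
  define L where "L = 2 * (K0 + a * Suc m) / a"
  have L: "L > 0" unfolding L_def using a K0 by (intro divide_pos_pos mult_pos_pos add_pos_nonneg) auto
  define K where "K = max (2 / a) (L ^ Suc m)"
  have "(1 + norm z) ^ Suc m \<le> K * (1 + norm (poly P z))" for z
  proof -
    define u where "u = 1 + norm z"
    have u: "u \<ge> 1" by (simp add: u_def)
    have "1 + real (Suc m) * (- (1 / u)) \<le> (1 + - (1 / u)) ^ Suc m"
      by (rule Bernoulli_inequality) (use u in simp)
    then have "(1 - real (Suc m) / u) * u ^ Suc m \<le> (1 - 1 / u) ^ Suc m * u ^ Suc m"
      using u by (intro mult_right_mono) auto
    also have "\<dots> = ((1 - 1 / u) * u) ^ Suc m" by (rule power_mult_distrib [symmetric])
    also have "(1 - 1 / u) * u = u - 1" using u by (simp add: left_diff_distrib)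
    also have "\<dots> = norm z" by (simp add: u_def)
    also have "(1 - real (Suc m) / u) * u ^ Suc m = u ^ Suc m - real (Suc m) * u ^ m"
      using u by (simp add: left_diff_distrib)
    finally have zu: "u ^ Suc m - real (Suc m) * u ^ m \<le> norm z ^ Suc m" .
    have "poly P z = lead_coeff P * z ^ Suc m + poly R z"
      by (simp add: R_def poly_monom Suc)
    then have "lead_coeff P * z ^ Suc m = poly P z - poly R z" by simp
    then have "a * norm z ^ Suc m = norm (poly P z - poly R z)"
      by (metis a_def norm_mult norm_power)
    also have "\<dots> \<le> norm (poly P z) + K0 * u ^ m"
      using norm_triangle_ineq4[of "poly P z" "poly R z"] K0(2)[of z] by (simp add: u_def)
    finally have "a * (u ^ Suc m - real (Suc m) * u ^ m) \<le> norm (poly P z) + K0 * u ^ m"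
      using mult_left_mono[OF zu, of a] a by linarith
    moreover have "a / 2 * L = K0 + a * Suc m" using a by (simp add: L_def)
    ultimately have main: "a * u ^ Suc m \<le> norm (poly P z) + a / 2 * L * u ^ m"
      by (simp only:) (simp add: algebra_simps)
    show ?thesis
    proof (cases "u \<ge> L")
      case True
      then have "a / 2 * L * u ^ m \<le> a / 2 * u ^ Suc m"
        using a u by (simp add: mult_right_mono)
      with main have "a * u ^ Suc m \<le> norm (poly P z) + a * u ^ Suc m / 2" by simp
      then have "u ^ Suc m \<le> 2 / a * norm (poly P z)"
        using a by (simp add: field_simps)
      also have "\<dots> \<le> K * (1 + norm (poly P z))"
        using a L unfolding K_def by (intro mult_mono) (auto simp: le_max_iff_disj)
      finally show ?thesis by (simp add: u_def)
    next
      case False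
      then have "u ^ Suc m \<le> L ^ Suc m" using u by (intro power_mono) auto
      also have "\<dots> \<le> K * (1 + norm (poly P z))"
        using mult_mono[of "L ^ Suc m" K 1 "1 + norm (poly P z)"] L
        by (simp add: K_def le_max_iff_disj)
      finally show ?thesis by (simp add: u_def)
    qed
  qed
  moreover have "K > 0" using a by (simp add: K_def less_max_iff_disj)
  ultimately show ?thesis using Suc by auto
qed

lemma poly_Taylor_2:
  fixes P :: "complex poly"
  assumes "\<And>u. u \<in> cball z 1 \<Longrightarrow> norm (poly (pderiv (pderiv P)) u) \<le> B" "w \<in> cball z 1"
  shows "norm (poly P w - poly P z - poly (pderiv P) z * (w - z)) \<le> B * (norm (w - z))\<^sup>2"
proof -
  define f where "f i = poly ((pderiv ^^ i) P)" for i
  have "norm (f 0 w - (\<Sum>i\<le>1. f i z * (w - z) ^ i / fact i)) \<le> B * norm (w - z) ^ Suc 1 / fact 1"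
  proof (rule complex_Taylor)
    show "(f i has_field_derivative f (Suc i) x) (at x within cball z 1)" for i x
      unfolding f_def using poly_DERIV[of "(pderiv ^^ i) P" x]
      by (simp add: has_field_derivative_at_within)
  qed (use assms in \<open>auto simp: f_def\<close>)
  then show ?thesis by (simp add: f_def power2_eq_square algebra_simps)
qed

text \<open>The constant \<open>C\<close> bounds how fast the graph leaves its tangent lines, measured by the squared
  distance in \<open>\<complex>\<^sup>2\<close>: its inverse controls the width of the tubular neighbourhood. Points with
  \<open>\<bar>w - z\<bar> \<ge> 1\<close> satisfy the first estimate trivially. For \<open>\<bar>w - z\<bar> \<le> 1\<close> Taylor's theorem reduces it to
  \<open>P''\<close> being dominated by \<open>1 + \<bar>P'\<bar>\<close>, which holds by comparing degrees.\<close>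

lemma poly_tangent_deviation:
  fixes P :: "complex poly"
  shows "\<exists>C>0. (\<forall>z w. norm (poly P w - poly P z - poly (pderiv P) z * (w - z))
              \<le> C * sqrt (1 + (norm (poly (pderiv P) z))\<^sup>2) *
                 ((norm (w - z))\<^sup>2 + (norm (poly P w - poly P z))\<^sup>2)) \<and>
           (\<forall>z. norm (poly (pderiv (pderiv P)) z) \<le> C * sqrt (1 + (norm (poly (pderiv P) z))\<^sup>2))"
proof -
  define P' P'' where "P' = pderiv P" "P'' = pderiv P'"
  define M where "M z = sqrt (1 + (norm (poly P' z))\<^sup>2)" for z
  have M: "M z \<ge> 1" "M z \<ge> norm (poly P' z)" for z
    by (auto simp: M_def intro: real_le_rsqrt)
  have "\<exists>C>0. \<forall>z u. u \<in> cball z 1 \<longrightarrow> norm (poly P'' u) \<le> C * M z"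
  proof (cases "P' = 0")
    case True
    then show ?thesis using M(1) by (intro exI[of _ 1]) (auto simp: P'_P''_def order_trans[OF zero_le_one])
  next
    case False
    define n where "n = degree P'"
    have "degree P'' \<le> n" by (simp add: n_def P'_P''_def degree_pderiv)
    then obtain K where K: "K > 0" "\<And>z. norm (poly P'' z) \<le> K * (1 + norm z) ^ n"
      using poly_norm_le_power by blast
    obtain L where L: "L > 0" "\<And>z. (1 + norm z) ^ n \<le> L * (1 + norm (poly P' z))"
      using power_le_poly_norm[OF False] n_def by blast
    have "norm (poly P'' u) \<le> (K * 2 ^ n * L * 2) * M z" if "u \<in> cball z 1" for z u
    proof -
      have "norm u \<le> norm z + 1"
        using that norm_triangle_sub[of u z] by (simp add: dist_norm norm_minus_commute)
      \<comment> \<open>The base of the powers at most doubles on the unit disc around \<open>z\<close>.\<close>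
      then have "1 + norm u \<le> 2 * (1 + norm z)"
        by (simp add: add_increasing2 order_trans)
      then have "(1 + norm u) ^ n \<le> (2 * (1 + norm z)) ^ n"
        by (intro power_mono) auto
      also have "\<dots> \<le> 2 ^ n * (L * (1 + norm (poly P' z)))"
        unfolding power_mult_distrib using L(2)[of z] by simp
      also have "\<dots> \<le> 2 ^ n * (L * (2 * M z))"
        using L(1) M[of z] by (intro mult_left_mono) auto
      finally have "K * (1 + norm u) ^ n \<le> K * (2 ^ n * (L * (2 * M z)))"
        using K(1) by (intro mult_left_mono) auto
      then show ?thesis using K(2)[of u] by (simp add: mult_ac)
    qed
    then show ?thesis using K(1) L(1) by (intro exI[of _ "K * 2 ^ n * L * 2"]) auto
  qed
  then obtain C where C: "C > 0" "\<And>z u. u \<in> cball z 1 \<Longrightarrow> norm (poly P'' u) \<le> C * M z" by blast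
  have "norm (poly P w - poly P z - poly P' z * (w - z))
      \<le> (C + 2) * M z * ((norm (w - z))\<^sup>2 + (norm (poly P w - poly P z))\<^sup>2)" for z w
  proof (cases "w \<in> cball z 1")
    case True
    then have "norm (poly P w - poly P z - poly P' z * (w - z)) \<le> (C * M z) * (norm (w - z))\<^sup>2"
      unfolding P'_P''_def using C(2)[of _ z] by (intro poly_Taylor_2) (auto simp: P'_P''_def)
    also have "\<dots> \<le> (C + 2) * M z * ((norm (w - z))\<^sup>2 + (norm (poly P w - poly P z))\<^sup>2)"
      using M(1)[of z] C(1) by (intro mult_mono) auto
    finally show ?thesis .
  next
    case False
    define h D where "h = norm (w - z)" "D = norm (poly P w - poly P z)"
    have h: "h \<ge> 1" "D \<ge> 0" using False by (auto simp: h_D_def dist_norm norm_minus_commute)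
    have "norm (poly P w - poly P z - poly P' z * (w - z)) \<le> D + norm (poly P' z) * h"
      unfolding h_D_def by (metis norm_mult norm_triangle_ineq4)
    also have "\<dots> \<le> D + M z * h" using M(2)[of z] h by (simp add: mult_right_mono)
    also have "\<dots> \<le> M z * (D + h)" using mult_right_mono[OF M(1)[of z] h(2)] by (simp add: algebra_simps)
    also have "\<dots> \<le> M z * (2 * (h\<^sup>2 + D\<^sup>2))"
    proof (rule mult_left_mono)
      have "h \<le> h\<^sup>2" using h by (simp add: power2_eq_square)
      moreover have "1 \<le> h\<^sup>2" using h by simp
      moreover have "D \<le> 1 + D\<^sup>2" using zero_le_power2[of "D - 1/2"] by (simp add: power2_eq_square algebra_simps)
      ultimately show "D + h \<le> 2 * (h\<^sup>2 + D\<^sup>2)"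
        using zero_le_power2[of D] unfolding distrib_left by linarith
    qed (use M(1)[of z] in simp)
    also have "\<dots> = 2 * M z * (h\<^sup>2 + D\<^sup>2)" by simp
    also have "\<dots> \<le> (C + 2) * M z * (h\<^sup>2 + D\<^sup>2)"
      using M(1)[of z] C(1) by (intro mult_right_mono) auto
    finally show ?thesis by (simp add: h_D_def)
  qed
  moreover have "norm (poly P'' z) \<le> (C + 2) * M z" for z
    using C(2)[of z z] M(1)[of z] by (simp add: algebra_simps)
  ultimately show ?thesis
    unfolding M_def P'_P''_def using C(1) by (intro exI[of _ "C + 2"]) auto
qed

section \<open>The tubular neighbourhood of a polynomial graph\<close>

definition vec2 :: "complex \<Rightarrow> complex \<Rightarrow> complex ^ 2" where
  "vec2 a b = (\<chi> i. if i = 1 then a else b)"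

lemma vec2_nth [simp]: "vec2 a b $ 1 = a" "vec2 a b $ 2 = b"
  by (simp_all add: vec2_def)

lemma vec2_eq_iff: "(x :: complex ^ 2) = y \<longleftrightarrow> x $ 1 = y $ 1 \<and> x $ 2 = y $ 2"
  by (auto simp: vec_eq_iff forall_2)

lemma norm_vec2_sq: "(norm (x :: complex ^ 2))\<^sup>2 = (norm (x $ 1))\<^sup>2 + (norm (x $ 2))\<^sup>2"
  by (simp add: norm_vec_def L2_set_def sum_2)

lemma inner_vec2: "(x :: complex ^ 2) \<bullet> y = Re (x $ 1 * cnj (y $ 1) + x $ 2 * cnj (y $ 2))"
  by (simp add: inner_vec_def sum_2 inner_complex_def)

lemma bounded_linear_vec2: "bounded_linear (\<lambda>p. vec2 (fst p) (snd p))"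
  by (intro linear_conv_bounded_linear[THEN iffD1] linearI) (auto simp: vec2_eq_iff)

lemma Ck_on_vec2:
  assumes "open S" "Ck_on k S f" "Ck_on k S g"
  shows "Ck_on k S (\<lambda>x. vec2 (f x) (g x))"
  using Ck_on_linear_comp[OF assms(1) bounded_linear_vec2 Ck_on_Pair[OF assms]] by simp

lemma has_derivative_vec2 [derivative_intros]:
  assumes "(f has_derivative f') (at x within S)" "(g has_derivative g') (at x within S)"
  shows "((\<lambda>x. vec2 (f x) (g x)) has_derivative (\<lambda>v. vec2 (f' v) (g' v))) (at x within S)"
  using bounded_linear.has_derivative[OF bounded_linear_vec2 has_derivative_Pair[OF assms]] by simp

lemma continuous_on_vec2 [continuous_intros]:
  assumes "continuous_on S f" "continuous_on S g"
  shows "continuous_on S (\<lambda>x. vec2 (f x) (g x))"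
  using bounded_linear.continuous_on[OF bounded_linear_vec2 continuous_on_Pair[OF assms]] by simp

definition graph_point :: "complex poly \<Rightarrow> complex \<Rightarrow> complex ^ 2" where
  "graph_point P z = vec2 z (poly P z)"

lemma poly_graph_eq_range: "poly_graph P = range (graph_point P)"
  by (auto simp: poly_graph_def graph_point_def vec2_eq_iff image_iff)

lemma graph_point_nth [simp]: "graph_point P z $ 1 = z" "graph_point P z $ 2 = poly P z"
  by (simp_all add: graph_point_def)

lemma continuous_on_graph_point [continuous_intros]:
  "continuous_on S f \<Longrightarrow> continuous_on S (\<lambda>x. graph_point P (f x))"
  unfolding graph_point_def by (intro continuous_intros)

lemma closed_poly_graph: "closed (poly_graph P)"
  unfolding poly_graph_def by (intro closed_Collect_eq continuous_intros)

lemma algebraic_curve_poly_graph: "algebraic_curve (poly_graph P)"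
  unfolding algebraic_curve_def poly_graph_def
  by (intro exI[of _ "[:- P, 1:]"]) auto

definition graph_function :: "complex poly \<Rightarrow> complex ^ 2 \<Rightarrow> complex" where
  "graph_function P p = p $ 2 - poly P (p $ 1)"

lemma has_derivative_poly_comp [derivative_intros]:
  fixes f :: "'a::real_normed_vector \<Rightarrow> complex"
  assumes "(f has_derivative f') (at x)"
  shows "((\<lambda>x. poly P (f x)) has_derivative (\<lambda>v. poly (pderiv P) (f x) * f' v)) (at x)"
  using has_derivative_compose[OF assms, of "poly P"]
  by (simp add: has_field_derivative_imp_has_derivative poly_DERIV)

lemma has_derivative_graph_function:
  "(graph_function P has_derivative (\<lambda>v. v $ 2 - poly (pderiv P) (p $ 1) * v $ 1)) (at p)"
  unfolding graph_function_def[abs_def]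
  by (intro derivative_intros bounded_linear_imp_has_derivative bounded_linear_vec_nth)

lemma cgrad_graph_function:
  "cgrad (graph_function P) p = vec2 (- poly (pderiv P) (p $ 1)) 1"
  unfolding cgrad_def d_z_def frechet_derivative_at[OF has_derivative_graph_function, symmetric]
  by (simp add: vec2_eq_iff axis_def field_simps)

lemma defining_function_graph_function: "defining_function (graph_function P) (poly_graph P)"
  unfolding defining_function_def entire_def
proof (intro conjI allI ballI)
  show "\<exists>L. (graph_function P has_derivative L) (at p) \<and> (\<forall>c v. L (c *s v) = c * L v)" for p
    using has_derivative_graph_function[of P p]
    by (intro exI[of _ "\<lambda>v. v $ 2 - poly (pderiv P) (p $ 1) * v $ 1"]) (auto simp: algebra_simps)
  show "cgrad (graph_function P) p \<noteq> 0" for p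
    by (auto simp: cgrad_graph_function vec2_eq_iff)
qed (auto simp: poly_graph_def graph_function_def)

definition normal_length :: "complex poly \<Rightarrow> complex \<Rightarrow> real" where
  "normal_length P z = sqrt (1 + (norm (poly (pderiv P) z))\<^sup>2)"

lemma normal_length_ge_1: "normal_length P z \<ge> 1"
  by (simp add: normal_length_def)

lemma normal_length_pos [simp]: "normal_length P z > 0" "normal_length P z \<noteq> 0"
  using normal_length_ge_1[of P z] by auto

definition graph_normal :: "complex poly \<Rightarrow> complex \<Rightarrow> complex ^ 2" where
  "graph_normal P z = vec2 (- cnj (poly (pderiv P) z)) 1"

lemma norm_graph_normal: "norm (graph_normal P z) = normal_length P z"
  unfolding normal_length_def
  by (rule real_sqrt_unique [symmetric]) (auto simp: norm_vec2_sq graph_normal_def add.commute)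

lemma norm_complex_scalar_mult_vec2: "norm (c *s (v :: complex ^ 2)) = norm c * norm v"
proof (rule power2_eq_imp_eq)
  show "(norm (c *s v))\<^sup>2 = (norm c * norm v)\<^sup>2"
    by (simp add: norm_vec2_sq norm_mult power_mult_distrib algebra_simps)
qed auto

lemma normal_map_graph_function:
  "normal_map (graph_function P) (p, t) = p + (t / normal_length P (p $ 1)) *s graph_normal P (p $ 1)"
proof -
  have "norm (cgrad (graph_function P) p) = normal_length P (p $ 1)"
    unfolding normal_length_def cgrad_graph_function
    by (rule real_sqrt_unique [symmetric]) (auto simp: norm_vec2_sq add.commute)
  then show ?thesis
    by (simp add: normal_map_def cgrad_graph_function graph_normal_def vec2_eq_iff scaleR_conv_of_real[where 'a=complex])
qed

text \<open>The pairing of a normal vector at \<open>z\<close> with a chord of the graph only sees the deviation of the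
  graph from its tangent line at \<open>z\<close>.\<close>

lemma inner_normal_chord:
  "((c *s graph_normal P z) \<bullet> (graph_point P w - graph_point P z))
    = Re (c * cnj (poly P w - poly P z - poly (pderiv P) z * (w - z)))"
  by (simp add: inner_vec2 graph_normal_def algebra_simps)

text \<open>The first estimate is global and keeps normal discs apart; the second bounds the curvature and makes the
  normal map a local diffeomorphism.\<close>

locale graph_tube =
  fixes P :: "complex poly" and C :: real
  assumes C_pos: "C > 0"
    and deviation: "\<And>z w. norm (poly P w - poly P z - poly (pderiv P) z * (w - z))
      \<le> C * normal_length P z * ((norm (w - z))\<^sup>2 + (norm (poly P w - poly P z))\<^sup>2)"
    and second: "\<And>z. norm (poly (pderiv (pderiv P)) z) \<le> C * normal_length P z"
begin

text \<open>Any radius below \<open>1 / (2 C)\<close> would do; this one makes the foot map Lipschitz with constant 2.\<close>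

definition "\<epsilon> = 1 / (4 * C)"

lemma eps_pos: "\<epsilon> > 0" and eps_C: "\<epsilon> * C = 1 / 4"
  using C_pos by (auto simp: \<epsilon>_def)

abbreviation tube_point :: "complex \<Rightarrow> complex \<Rightarrow> complex ^ 2" where
  "tube_point z t \<equiv> graph_point P z + (t / normal_length P z) *s graph_normal P z"

text \<open>For the chord \<open>d\<close> and the normal vector \<open>n\<close> of length \<open>\<bar>t\<bar>\<close> this gives \<open>\<bar>n - d\<bar>\<^sup>2 \<ge> \<bar>t\<bar>\<^sup>2 + \<bar>d\<bar>\<^sup>2 / 2\<close>: no other point of the
  graph is as near to the tip of \<open>n\<close> as its foot.\<close>

lemma inner_normal_chord_le:
  fixes t :: complex
  assumes "norm t < \<epsilon>"
  shows "((t / normal_length P z) *s graph_normal P z) \<bullet> (graph_point P w - graph_point P z)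
      \<le> (norm (graph_point P w - graph_point P z))\<^sup>2 / 4"
proof -
  let ?m = "normal_length P z" and ?E = "poly P w - poly P z - poly (pderiv P) z * (w - z)"
  let ?d = "(norm (graph_point P w - graph_point P z))\<^sup>2"
  have "((t / ?m) *s graph_normal P z) \<bullet> (graph_point P w - graph_point P z)
      \<le> norm (t / ?m * cnj ?E)"
    unfolding inner_normal_chord by (rule complex_Re_le_cmod)
  also have "\<dots> = norm t / ?m * norm ?E"
    by (simp only: norm_mult norm_divide complex_mod_cnj norm_of_real) (simp add: abs_of_pos)
  also have "\<dots> \<le> norm t / ?m * (C * ?m * ?d)"
    using deviation[of w z] by (intro mult_left_mono) (auto simp: norm_vec2_sq less_imp_le)
  also have "\<dots> = (norm t * C) * ?d" by simp
  also have "\<dots> \<le> (\<epsilon> * C) * ?d" using assms C_pos by (intro mult_right_mono) auto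
  finally show ?thesis by (simp add: eps_C)
qed

text \<open>The chord \<open>d\<close> between two feet makes an almost right angle with both normals, so the distance of
  the two points above cannot be much smaller than the length of \<open>d\<close>.\<close>

lemma foot_Lipschitz:
  assumes "norm t < \<epsilon>" "norm s < \<epsilon>"
  shows "norm (graph_point P z - graph_point P w) \<le> 2 * norm (tube_point z t - tube_point w s)"
proof -
  let ?n = "(t / normal_length P z) *s graph_normal P z"
  let ?m = "(s / normal_length P w) *s graph_normal P w"
  define d where "d = graph_point P w - graph_point P z"
  have "?n \<bullet> d \<le> (norm d)\<^sup>2 / 4"
    unfolding d_def by (rule inner_normal_chord_le[OF assms(1)])
  moreover have "?m \<bullet> (- d) \<le> (norm d)\<^sup>2 / 4"
    using inner_normal_chord_le[OF assms(2), of w z] by (simp add: d_def norm_minus_commute)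
  moreover have "tube_point w s - tube_point z t = d + ?m - ?n" by (simp add: d_def)
  then have "(tube_point w s - tube_point z t) \<bullet> d = (norm d)\<^sup>2 - ?m \<bullet> (- d) - ?n \<bullet> d"
    by (simp only: inner_diff_left inner_add_left power2_norm_eq_inner inner_minus_right)
  ultimately have "(norm d)\<^sup>2 / 2 \<le> (tube_point w s - tube_point z t) \<bullet> d" by linarith
  also have "\<dots> \<le> norm (tube_point w s - tube_point z t) * norm d" by (rule norm_cauchy_schwarz)
  finally have "norm d * norm d \<le> (2 * norm (tube_point w s - tube_point z t)) * norm d"
    by (simp add: power2_eq_square)
  then have "norm d \<le> 2 * norm (tube_point w s - tube_point z t)"
    by (cases "norm d = 0") (auto simp: mult_le_cancel_right)
  then show ?thesis by (simp add: d_def norm_minus_commute)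
qed

lemma tube_point_inj:
  assumes "norm t < \<epsilon>" "norm s < \<epsilon>" "tube_point z t = tube_point w s"
  shows "z = w \<and> t = s"
proof -
  have "graph_point P z = graph_point P w"
    using foot_Lipschitz[OF assms(1,2), of z w] assms(3) by simp
  then have "z = w" by (metis graph_point_nth(1))
  with assms(3) show ?thesis by (auto simp: vec2_eq_iff graph_normal_def)
qed

lemma tube_point_in_nbhd:
  assumes "norm t < \<epsilon>"
  shows "tube_point z t \<in> nbhd \<epsilon> (poly_graph P)"
proof -
  have "dist (graph_point P z) (tube_point z t) = norm t"
    by (simp add: dist_norm norm_complex_scalar_mult_vec2 norm_graph_normal norm_divide abs_of_pos)
  then have "tube_point z t \<in> ball (graph_point P z) \<epsilon>" using assms by simp
  then show ?thesis
    unfolding nbhd_def poly_graph_eq_range by blast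
qed

text \<open>A nearest point of the graph is a foot: the squared distance is stationary there.\<close>

lemma tube_point_surj:
  assumes "y \<in> nbhd \<epsilon> (poly_graph P)"
  shows "\<exists>z t. norm t < \<epsilon> \<and> tube_point z t = y"
proof -
  obtain p0 where p0: "p0 \<in> poly_graph P" "dist p0 y < \<epsilon>"
    using assms by (auto simp: nbhd_def)
  obtain p where p: "p \<in> poly_graph P" "\<And>q. q \<in> poly_graph P \<Longrightarrow> dist y p \<le> dist y q"
    using distance_attains_inf[OF closed_poly_graph, of P y] p0(1) by blast
  obtain z where z: "p = graph_point P z" using p(1) by (auto simp: poly_graph_eq_range)
  define n where "n = y - p"
  have n_less: "norm n < \<epsilon>"
    using p(2)[OF p0(1)] p0(2) by (simp add: n_def dist_norm norm_minus_commute)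
  define f where "f w = (y - graph_point P w) \<bullet> (y - graph_point P w)" for w
  have der: "(f has_derivative (\<lambda>h. - 2 * (n \<bullet> vec2 h (poly (pderiv P) z * h)))) (at z)"
    unfolding f_def graph_point_def n_def z
    by (rule has_derivative_eq_rhs, (rule derivative_intros)+) (auto simp: inner_commute)
  have "f z \<le> f w" for w
    using p(2)[of "graph_point P w"] z by (simp add: f_def poly_graph_eq_range dist_norm norm_le)
  then have "(\<lambda>h. - 2 * (n \<bullet> vec2 h (poly (pderiv P) z * h))) = (\<lambda>h. 0)"
    using has_derivative_local_min[OF der] by (auto intro: always_eventually)
  from fun_cong[OF this] have stat: "n \<bullet> vec2 h (poly (pderiv P) z * h) = 0" for h by simp
  \<comment> \<open>The derivative in the direction \<open>h\<close> is \<open>- 2 Re (k cnj h)\<close>; take \<open>h = k\<close>.\<close>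
  define k where "k = n $ 1 + n $ 2 * cnj (poly (pderiv P) z)"
  have "Re (k * cnj k) = 0"
    using stat[of k] by (simp add: inner_vec2 k_def algebra_simps)
  then have "k = 0" by (simp add: complex_mult_cnj complex_eq_iff)
  then have n: "n = n $ 2 *s graph_normal P z"
    by (simp add: vec2_eq_iff graph_normal_def k_def eq_neg_iff_add_eq_0)
  define t where "t = n $ 2 * normal_length P z"
  have "norm t = norm n"
    by (subst n) (simp add: t_def norm_complex_scalar_mult_vec2 norm_graph_normal norm_mult abs_of_pos)
  moreover have "tube_point z t = y" 
  proof -
    have "tube_point z t = p + n" using n z by (simp add: t_def)
    then show ?thesis by (simp add: n_def)
  qed
  ultimately show ?thesis using n_less by metis
qed

end

lemma Ck_on_ident: "open S \<Longrightarrow> Ck_on k S (\<lambda>x. x)"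
  by (rule Ck_on_bounded_linear) (auto intro: bounded_linear_ident)

lemmas Ck_on_intros = Ck_on_ident Ck_on_const Ck_on_minus Ck_on_add Ck_on_diff Ck_on_mult Ck_on_scaleR
  Ck_on_inverse Ck_on_sqrt Ck_on_poly Ck_on_cnj Ck_on_Re Ck_on_of_real Ck_on_fst Ck_on_snd Ck_on_nth
  Ck_on_Pair Ck_on_vec2

context graph_tube
begin

abbreviation Tube :: "(complex ^ 2) set" where
  "Tube \<equiv> nbhd \<epsilon> (poly_graph P)"

lemma open_Tube: "open Tube"
  unfolding nbhd_def by (intro open_UN ballI open_ball)

definition foot :: "complex ^ 2 \<Rightarrow> complex" where
  "foot y = (SOME z. \<exists>t. norm t < \<epsilon> \<and> tube_point z t = y)"

definition height :: "complex ^ 2 \<Rightarrow> complex" where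
  "height y = y $ 2 - poly P (foot y)"

lemma foot_tube_point:
  assumes "norm t < \<epsilon>"
  shows "foot (tube_point z t) = z" and "height (tube_point z t) * normal_length P z = t"
proof -
  have "\<exists>s. norm s < \<epsilon> \<and> tube_point (foot (tube_point z t)) s = tube_point z t"
    unfolding foot_def using assms by (intro someI_ex[of "\<lambda>w. \<exists>s. norm s < \<epsilon> \<and> tube_point w s = tube_point z t"]) blast
  then show "foot (tube_point z t) = z" using tube_point_inj[OF _ assms] by blast
  then show "height (tube_point z t) * normal_length P z = t"
    by (simp add: height_def graph_normal_def)
qed

lemma tube_point_foot:
  assumes "y \<in> Tube"
  obtains "norm (height y * normal_length P (foot y)) < \<epsilon>"
    and "tube_point (foot y) (height y * normal_length P (foot y)) = y"
proof -
  obtain z t where "norm t < \<epsilon>" "tube_point z t = y" using tube_point_surj[OF assms] by blast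
  then have "foot y = z" "height y * normal_length P z = t" using foot_tube_point[of t z] by auto
  with that \<open>norm t < \<epsilon>\<close> \<open>tube_point z t = y\<close> show ?thesis by metis
qed

lemma foot_continuous_on: "continuous_on Tube foot"
proof (rule lipschitz_on_continuous_on)
  show "2-lipschitz_on Tube foot"
  proof (rule lipschitz_onI)
    fix x y assume "x \<in> Tube" "y \<in> Tube"
    then have "norm (graph_point P (foot x) - graph_point P (foot y)) \<le> 2 * norm (x - y)"
      using foot_Lipschitz by (metis tube_point_foot)
    moreover have "norm (foot x - foot y) \<le> norm (graph_point P (foot x) - graph_point P (foot y))"
      using Finite_Cartesian_Product.norm_nth_le[of "graph_point P (foot x) - graph_point P (foot y)" 1] by simp
    ultimately show "dist (foot x) (foot y) \<le> 2 * dist x y" by (simp add: dist_norm)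
  qed simp
qed

text \<open>The derivative of the foot map solves \<open>a h + b \<cdot> cnj h = k\<close>, where \<open>a\<close> is real and \<open>\<bar>b\<bar> < a\<close> expresses
  that the tube is thinner than the radius of curvature.\<close>

definition foot_deriv :: "complex ^ 2 \<Rightarrow> complex ^ 2 \<Rightarrow> complex" where
  "foot_deriv y v = (let q = poly (pderiv P) (foot y);
      a = 1 + Re (q * cnj q);
      b = - (height y * cnj (poly (pderiv (pderiv P)) (foot y)));
      k = v $ 1 + cnj q * v $ 2
    in inverse (a * a - Re (b * cnj b)) *\<^sub>R (a *\<^sub>R k - b * cnj k))"

lemma foot_deriv_denominator:
  assumes "y \<in> Tube"
  defines "q \<equiv> poly (pderiv P) (foot y)"
  defines "a \<equiv> 1 + Re (q * cnj q)"
    and "b \<equiv> - (height y * cnj (poly (pderiv (pderiv P)) (foot y)))"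
  shows "a * a - Re (b * cnj b) > 0"
proof -
  let ?m = "normal_length P (foot y)"
  have "norm (height y) * norm (poly (pderiv (pderiv P)) (foot y)) \<le> norm (height y) * (C * ?m)"
    using second by (intro mult_left_mono) auto
  also have "\<dots> = norm (height y * ?m) * C" by (simp add: norm_mult abs_of_pos)
  also have "\<dots> \<le> \<epsilon> * C"
  proof (rule mult_right_mono)
    show "norm (height y * ?m) \<le> \<epsilon>" by (rule tube_point_foot[OF assms(1)]) simp
  qed (use C_pos in simp)
  finally have "norm b \<le> 1/4" by (simp add: b_def norm_mult eps_C)
  moreover have "a \<ge> 1" by (simp add: a_def)
  ultimately have "norm b < a" by linarith
  then have "norm b * norm b < a * a" by (intro mult_strict_mono') auto
  moreover have "Re (b * cnj b) = norm b * norm b"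
    by (simp add: cmod_power2 flip: power2_eq_square)
  ultimately show ?thesis by simp
qed

lemma has_derivative_foot:
  assumes "y \<in> Tube"
  shows "(foot has_derivative foot_deriv y) (at y)"
proof -
  \<comment> \<open>\<open>f\<close> is the normal map with normals of second coordinate 1, and \<open>G\<close> is its inverse on the tube. As \<open>G\<close> is
    continuous, a left inverse \<open>G'\<close> of the derivative of \<open>f\<close> is the derivative of \<open>G\<close>.\<close>
  define z s q r where "z = foot y" "s = height y" "q = poly (pderiv P) z" "r = poly (pderiv (pderiv P)) z"
  define f where "f = (\<lambda>(z, s). vec2 (z - s * cnj (poly (pderiv P) z)) (poly P z + s))"
  define f' where "f' = (\<lambda>(h, \<sigma>). vec2 (h - (\<sigma> * cnj q + s * cnj (r * h))) (q * h + \<sigma>))"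
  define G where "G x = (foot x, height x)" for x
  define G' where "G' v = (foot_deriv y v, v $ 2 - q * foot_deriv y v)" for v
  have fG: "f (G x) = x" if "x \<in> Tube" for x
  proof -
    have "tube_point (foot x) (height x * normal_length P (foot x)) = x" using tube_point_foot[OF that] by blast
    then show ?thesis by (simp add: f_def G_def graph_normal_def vec2_eq_iff algebra_simps)
  qed
  have linear_foot_deriv: "linear (foot_deriv y)"
    by (rule linearI) (simp_all add: foot_deriv_def Let_def algebra_simps)
  have "(G has_derivative G') (at y)"
  proof (rule has_derivative_inverse_basic[where f = f and f' = f' and T = Tube])
    have f_eq: "f = (\<lambda>x. vec2 (fst x - snd x * cnj (poly (pderiv P) (fst x))) (poly P (fst x) + snd x))"
      by (auto simp: f_def)
    show "(f has_derivative f') (at (G y))"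
      unfolding f_eq
      by (rule has_derivative_eq_rhs, (rule derivative_intros bounded_linear.has_derivative[OF bounded_linear_cnj])+)
        (auto simp: f'_def G_def z_s_q_r_def algebra_simps)
    have "linear G'"
      using linear_foot_deriv by (intro linearI) (simp_all add: G'_def linear_add linear_scale algebra_simps)
    then show "bounded_linear G'" by (simp add: linear_conv_bounded_linear)
    show "G' \<circ> f' = id"
    proof (rule ext)
      fix v :: "complex \<times> complex"
      obtain h \<sigma> where v: "v = (h, \<sigma>)" by fastforce
      define a b where "a = 1 + Re (q * cnj q)" "b = - (s * cnj r)"
      define k where "k = a *\<^sub>R h + b * cnj h"
      have ac: "complex_of_real a = 1 + q * cnj q"
        by (simp add: a_b_def complex_eq_iff)
      have bc: "complex_of_real (Re (b * cnj b)) = b * cnj b"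
        by (simp add: complex_eq_iff)
      have D: "a * a - Re (b * cnj b) \<noteq> 0"
        using foot_deriv_denominator[OF assms] by (simp add: a_b_def z_s_q_r_def)
      have fd: "foot_deriv y v = inverse (a * a - Re (b * cnj b)) *\<^sub>R
          (a *\<^sub>R (v $ 1 + cnj q * v $ 2) - b * cnj (v $ 1 + cnj q * v $ 2))" for v
        by (simp only: foot_deriv_def Let_def a_b_def z_s_q_r_def)
      have "f' v $ 1 + cnj q * f' v $ 2 = k"
        by (simp add: v f'_def k_def scaleR_conv_of_real ac a_b_def(2) algebra_simps)
      then have "foot_deriv y (f' v) = inverse (a * a - Re (b * cnj b)) *\<^sub>R (a *\<^sub>R k - b * cnj k)"
        by (simp only: fd)
      also have "a *\<^sub>R k - b * cnj k = (a * a - Re (b * cnj b)) *\<^sub>R h"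
      proof -
        have "a *\<^sub>R k - b * cnj k = (of_real a * of_real a - b * cnj b) * h"
          by (simp add: k_def scaleR_conv_of_real algebra_simps)
        also have "\<dots> = (a * a - Re (b * cnj b)) *\<^sub>R h"
          by (simp only: bc scaleR_conv_of_real of_real_diff of_real_mult)
        finally show ?thesis .
      qed
      finally have "foot_deriv y (f' v) = h" using D by simp
      then show "(G' \<circ> f') v = id v" by (simp add: G'_def v f'_def)
    qed
    show "continuous (at y) G"
    proof -
      have "continuous_on Tube G"
        unfolding G_def height_def by (intro continuous_intros foot_continuous_on)
      then show ?thesis using assms open_Tube by (simp add: continuous_on_eq_continuous_at)
    qed
  qed (use assms open_Tube fG in auto)
  from has_derivative_fst[OF this] show ?thesis unfolding G_def G'_def fst_conv .
qed

text \<open>As \<open>foot_deriv\<close> is a smooth expression in the foot itself, each order of smoothness yields the next.\<close>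

lemma Ck_on_foot: "Ck_on k Tube foot"
proof (induction k)
  case 0
  then show ?case by (simp add: foot_continuous_on)
next
  case (Suc k)
  show ?case
  proof (rule Ck_on_SucI[OF open_Tube has_derivative_foot])
    fix v
    have h: "Ck_on k Tube height"
      unfolding height_def[abs_def]
      by (intro Ck_on_intros Suc.IH open_Tube)
    show "Ck_on k Tube (\<lambda>x. foot_deriv x v)"
      unfolding foot_deriv_def Let_def
    proof (intro Ck_on_intros Suc.IH h open_Tube)
      fix y assume "y \<in> Tube"
      from foot_deriv_denominator[OF this] show "(1 + Re (poly (pderiv P) (foot y) * cnj (poly (pderiv P) (foot y)))) *
          (1 + Re (poly (pderiv P) (foot y) * cnj (poly (pderiv P) (foot y)))) -
          Re (- (height y * cnj (poly (pderiv (pderiv P)) (foot y))) *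
              cnj (- (height y * cnj (poly (pderiv (pderiv P)) (foot y))))) \<noteq> 0"
        by (rule less_imp_neq[symmetric])
    qed
  qed
qed

lemma uniformly_flat_poly_graph: "uniformly_flat (poly_graph P)"
  unfolding uniformly_flat_def
proof (rule exI[of _ "graph_function P"], rule conjI, rule defining_function_graph_function,
    rule exI[of _ \<epsilon>], rule conjI, rule eps_pos)
  let ?N = "normal_map (graph_function P)" and ?A = "poly_graph P \<times> ball 0 \<epsilon>"
  have N: "?N (graph_point P z, t) = tube_point z t" for z t by (simp add: normal_map_graph_function)
  have inj: "inj_on ?N ?A"
  proof (rule inj_onI)
    fix x y assume x: "x \<in> ?A" and y: "y \<in> ?A" and eq: "?N x = ?N y"
    obtain z t where zt: "x = (graph_point P z, t)" "norm t < \<epsilon>"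
      using x by (auto simp: poly_graph_eq_range)
    obtain w s where ws: "y = (graph_point P w, s)" "norm s < \<epsilon>"
      using y by (auto simp: poly_graph_eq_range)
    show "x = y" using tube_point_inj[OF zt(2) ws(2)] eq zt(1) ws(1) N by metis
  qed
  have image: "?N ` ?A = Tube"
  proof (intro equalityI subsetI)
    fix y assume "y \<in> ?N ` ?A"
    then obtain z t where "y = ?N (graph_point P z, t)" "norm t < \<epsilon>"
      by (auto simp: poly_graph_eq_range)
    then show "y \<in> Tube" using N tube_point_in_nbhd by metis
  next
    fix y assume "y \<in> Tube"
    then obtain z t where "norm t < \<epsilon>" "tube_point z t = y" using tube_point_surj by blast
    then show "y \<in> ?N ` ?A"
      using N by (intro image_eqI[of _ _ "(graph_point P z, t)"]) (auto simp: poly_graph_eq_range)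
  qed
  define G where "G y = (vec2 (foot y) (poly P (foot y)), height y * of_real (sqrt (1 + Re (poly (pderiv P) (foot y) * cnj (poly (pderiv P) (foot y))))))" for y
  have "inv_into ?A ?N y = G y" if y: "y \<in> Tube" for y
  proof -
    obtain z t where t: "norm t < \<epsilon>" "tube_point z t = y" using tube_point_surj[OF y] by blast
    have "G (tube_point z t) = (graph_point P z, t)"
      using foot_tube_point[OF t(1), of z]
      by (simp add: G_def graph_point_def normal_length_def cmod_power2 flip: power2_eq_square)
    moreover have "inv_into ?A ?N (?N (graph_point P z, t)) = (graph_point P z, t)"
      using t(1) by (intro inv_into_f_f[OF inj]) (auto simp: poly_graph_eq_range)
    ultimately show ?thesis using t(2) N by simp
  qed
  moreover have "smooth_on_open Tube G"
    unfolding smooth_on_open_def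
  proof (intro conjI allI open_Tube)
    fix k
    have pos: "0 < 1 + Re (poly (pderiv P) (foot y) * cnj (poly (pderiv P) (foot y)))" for y
      by (simp add: add_pos_nonneg)
    show "Ck_on k Tube G"
      unfolding G_def[abs_def] height_def
      by (intro Ck_on_intros Ck_on_foot open_Tube pos)
  qed
  ultimately have "smooth_map_on Tube (inv_into ?A ?N)"
    unfolding smooth_map_on_def by (metis IntD1)
  moreover have "smooth_map_on ?A ?N"
  proof -
    have N_eq: "?N = (\<lambda>x. fst x + (let q = poly (pderiv P) (fst x $ 1);
        m = inverse (sqrt (1 + Re (q * cnj q))) in
        vec2 (m *\<^sub>R (snd x * (- cnj q))) (m *\<^sub>R snd x)))"
    proof (rule ext)
      fix x :: "(complex ^ 2) \<times> complex"
      show "?N x = fst x + (let q = poly (pderiv P) (fst x $ 1);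
        m = inverse (sqrt (1 + Re (q * cnj q))) in
        vec2 (m *\<^sub>R (snd x * (- cnj q))) (m *\<^sub>R snd x))"
        by (cases x) (simp add: normal_map_graph_function Let_def vec2_eq_iff graph_normal_def
            normal_length_def cmod_power2 scaleR_conv_of_real divide_inverse mult_ac flip: power2_eq_square)
    qed
    have pos: "0 < 1 + Re (q * cnj q)" for q
      by (simp add: add_pos_nonneg)
    have "Ck_on k UNIV ?N" for k
      unfolding N_eq Let_def
      by (intro Ck_on_intros open_UNIV pos less_imp_neq[OF real_sqrt_gt_zero[OF pos], symmetric])
    then have "smooth_on_open UNIV ?N" by (simp add: smooth_on_open_def)
    then show ?thesis unfolding smooth_map_on_def by (metis UNIV_I)
  qed
  ultimately show "diffeomorphism_between ?A Tube ?N"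
    unfolding diffeomorphism_between_def bij_betw_def by (intro conjI inj image)
qed

end

theorem uniformly_flat_poly_graph: "uniformly_flat (poly_graph P)"
proof -
  obtain C where "graph_tube P C"
    using poly_tangent_deviation[of P] by (auto simp: graph_tube_def normal_length_def)
  then show ?thesis by (rule graph_tube.uniformly_flat_poly_graph)
qed

section \<open>Integration by parts\<close>

lemma integrable_continuous_compact_support:
  fixes f :: "'a::euclidean_space \<Rightarrow> 'b::{banach, second_countable_topology}"
  assumes "continuous_on UNIV f" "compact K" "\<And>x. x \<notin> K \<Longrightarrow> f x = 0"
  shows "integrable lborel f"
proof -
  have "integrable lborel (\<lambda>x. indicator K x *\<^sub>R f x)"
    using assms by (intro borel_integrable_compact) (auto intro: continuous_on_subset)
  moreover have "(\<lambda>x. indicator K x *\<^sub>R f x) = f"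
    using assms(3) by (auto simp: indicator_def fun_eq_iff)
  ultimately show ?thesis by simp
qed

lemma has_derivative_zero_off_support:
  assumes "closed K" "\<And>x. x \<notin> K \<Longrightarrow> f x = 0" "x \<notin> K" "(f has_derivative f') (at x)"
  shows "f' v = 0"
proof -
  have "((\<lambda>x. 0) has_derivative f') (at x)"
    by (rule has_derivative_transform_within_open[OF assms(4), of "- K"]) (use assms in auto)
  then have "f' = (\<lambda>v. 0)" using has_derivative_unique has_derivative_const by blast
  then show ?thesis by simp
qed

lemma lborel_integral_translation:
  fixes f :: "'a::euclidean_space \<Rightarrow> 'b::{banach, second_countable_topology}"
  assumes [measurable]: "f \<in> borel_measurable borel"
  shows "(LINT x|lborel. f (x + c)) = (LINT x|lborel. f x)"
proof -
  have "(LINT x|lborel. f x) = (LINT x|distr lborel borel ((+) c). f x)"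
    by (simp add: lborel_distr_plus)
  also have "\<dots> = (LINT x|lborel. f (c + x))" by (rule integral_distr) auto
  finally show ?thesis by (simp add: add.commute)
qed

text \<open>The integral of \<open>f (x + t v)\<close> over \<open>x\<close> does not depend on \<open>t\<close>; its derivative at \<open>t = 0\<close> is the
  integral of the directional derivative.\<close>

lemma integral_directional_derivative_eq_0:
  fixes f :: "'a::euclidean_space \<Rightarrow> 'b::euclidean_space"
  assumes der: "\<And>x. (f has_derivative f' x) (at x)" and cont: "continuous_on UNIV (\<lambda>x. f' x v)"
    and K: "compact K" "\<And>x. x \<notin> K \<Longrightarrow> f x = 0"
  shows "(LINT x|lborel. f' x v) = 0"
proof -
  obtain R where R: "\<And>x. x \<in> K \<Longrightarrow> norm x \<le> R"
    using compact_imp_bounded[OF K(1)] by (auto simp: bounded_iff)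
  \<comment> \<open>The box contains the supports of all translates by \<open>t v\<close> with \<open>\<bar>t\<bar> \<le> 1\<close>.\<close>
  obtain a :: 'a where a: "cball 0 (R + norm v) \<subseteq> cbox (- a) a"
    using bounded_subset_cbox_symmetric[OF bounded_cball] by blast
  have contf: "continuous_on UNIV f"
    by (rule has_derivative_continuous_on[OF has_derivative_at_withinI[OF der]])
  have box: "integral (cbox (- a) a) g = (LINT x|lborel. g x)"
    if g: "continuous_on UNIV g" "\<And>x :: 'a. x \<notin> cball 0 (R + norm v) \<Longrightarrow> g x = 0" for g :: "'a \<Rightarrow> 'b"
  proof -
    have "integral (cbox (- a) a) g = integral UNIV g"
    proof -
      have "(\<lambda>x. if x \<in> cbox (- a) a then g x else 0) = g"
      proof (rule ext)
        fix x
        show "(if x \<in> cbox (- a) a then g x else 0) = g x"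
          using subsetD[OF a, of x] g(2)[of x] by auto
      qed
      then show ?thesis using integral_restrict_UNIV[of "cbox (- a) a" g] by simp
    qed
    also have "\<dots> = (LINT x|lborel. g x)"
      by (rule integral_lborel integrable_continuous_compact_support[OF g(1) compact_cball g(2)])+
    finally show ?thesis .
  qed
  define h where "h t = integral (cbox (- a) a) (\<lambda>x. f (x + t *\<^sub>R v))" for t
  have h_const: "h t = (LINT x|lborel. f x)" if t: "t \<in> {-1..1}" for t
  proof -
    have "h t = (LINT x|lborel. f (x + t *\<^sub>R v))"
      unfolding h_def
    proof (rule box)
      show "continuous_on UNIV (\<lambda>x. f (x + t *\<^sub>R v))"
        by (intro continuous_on_compose2[OF contf] continuous_intros) auto
      fix x :: 'a assume x: "x \<notin> cball 0 (R + norm v)"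
      have "norm x \<le> norm (x + t *\<^sub>R v) + norm (t *\<^sub>R v)"
        using norm_triangle_ineq4[of "x + t *\<^sub>R v" "t *\<^sub>R v"] by simp
      moreover have "norm (t *\<^sub>R v) \<le> norm v"
        using t by (auto simp: mult_left_le_one_le abs_le_iff)
      ultimately have "norm (x + t *\<^sub>R v) > R" using x by simp
      then have "x + t *\<^sub>R v \<notin> K" using R by force
      then show "f (x + t *\<^sub>R v) = 0" by (rule K(2))
    qed
    also have "\<dots> = (LINT x|lborel. f x)"
      using contf by (intro lborel_integral_translation borel_measurable_continuous_onI)
    finally show ?thesis .
  qed
  have "(h has_vector_derivative integral (cbox (- a) a) (\<lambda>x. f' (x + 0 *\<^sub>R v) v)) (at 0 within {-1..1})"
    unfolding h_def
  proof (rule leibniz_rule_vector_derivative[where fx = "\<lambda>t x. f' (x + t *\<^sub>R v) v"])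
    fix t :: real and x
    interpret bounded_linear "f' y" for y by (rule has_derivative_bounded_linear[OF der])
    have "((\<lambda>t. f (x + t *\<^sub>R v)) has_derivative (\<lambda>s. f' (x + t *\<^sub>R v) (s *\<^sub>R v))) (at t within {-1..1})"
      by (rule has_derivative_compose[OF _ der]) (auto intro!: derivative_eq_intros)
    then show "((\<lambda>t. f (x + t *\<^sub>R v)) has_vector_derivative f' (x + t *\<^sub>R v) v) (at t within {-1..1})"
      by (simp add: has_vector_derivative_def scaleR)
    show "(\<lambda>x. f (x + t *\<^sub>R v)) integrable_on cbox (- a) a"
      by (intro integrable_continuous continuous_on_compose2[OF contf] continuous_intros) auto
    show "continuous_on ({-1..1} \<times> cbox (- a) a) (\<lambda>(t, x). f' (x + t *\<^sub>R v) v)"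
      unfolding case_prod_unfold
      by (intro continuous_on_compose2[OF cont] continuous_intros) auto
  qed auto
  moreover have "(h has_vector_derivative 0) (at 0 within {-1..1})"
    by (rule has_vector_derivative_transform[OF _ _ has_vector_derivative_const[of "LINT x|lborel. f x"]])
      (use h_const in auto)
  ultimately have "integral (cbox (- a) a) (\<lambda>x. f' (x + 0 *\<^sub>R v) v) = 0"
    using vector_derivative_unique_within_closed_interval[of "-1" 1 0 h] by auto
  moreover have "f' x v = 0" if "x \<notin> cball 0 (R + norm v)" for x :: 'a
  proof -
    have "x \<notin> K"
    proof
      assume "x \<in> K"
      then show False using that R[of x] norm_ge_zero[of v] by (simp del: norm_ge_zero)
    qed
    then show ?thesis
      using has_derivative_zero_off_support[OF compact_imp_closed[OF K(1)] K(2) _ der] by blast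
  qed
  then have "integral (cbox (- a) a) (\<lambda>x. f' x v) = (LINT x|lborel. f' x v)"
    by (intro box cont)
  ultimately show ?thesis by simp
qed

lemma Ck_on_Suc_continuous_frechet_derivative:
  "Ck_on (Suc k) UNIV f \<Longrightarrow> continuous_on UNIV (\<lambda>x. frechet_derivative f (at x) v)"
  by (auto intro: Ck_on_imp_continuous_on)

lemma Ck_on_Suc_has_derivative:
  "Ck_on (Suc k) UNIV f \<Longrightarrow> (f has_derivative frechet_derivative f (at x)) (at x)"
  by (simp add: frechet_derivative_works)

lemma integration_by_parts:
  fixes u f :: "'a::euclidean_space \<Rightarrow> complex"
  assumes u: "Ck_on (Suc i) UNIV u" and f: "Ck_on (Suc j) UNIV f"
    and K: "compact K" "\<And>x. x \<notin> K \<Longrightarrow> f x = 0"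
  shows "integrable lborel (\<lambda>x. u x * frechet_derivative f (at x) v)"
    and "integrable lborel (\<lambda>x. frechet_derivative u (at x) v * f x)"
    and "(LINT x|lborel. u x * frechet_derivative f (at x) v)
      = - (LINT x|lborel. frechet_derivative u (at x) v * f x)"
proof -
  note der = Ck_on_Suc_has_derivative[OF u] Ck_on_Suc_has_derivative[OF f]
  note cont = Ck_on_Suc_continuous_frechet_derivative[OF u] Ck_on_Suc_continuous_frechet_derivative[OF f]
    Ck_on_imp_continuous_on[OF u] Ck_on_imp_continuous_on[OF f]
  have "frechet_derivative f (at x) v = 0" if "x \<notin> K" for x
    by (rule has_derivative_zero_off_support[OF compact_imp_closed[OF K(1)] K(2) that der(2)])
  then show int1: "integrable lborel (\<lambda>x. u x * frechet_derivative f (at x) v)"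
    by (intro integrable_continuous_compact_support[OF _ K(1)] continuous_intros cont) auto
  show int2: "integrable lborel (\<lambda>x. frechet_derivative u (at x) v * f x)"
    by (intro integrable_continuous_compact_support[OF _ K(1)] continuous_intros cont) (simp add: K(2))
  have "(LINT x|lborel. u x * frechet_derivative f (at x) v + frechet_derivative u (at x) v * f x) = 0"
    by (rule integral_directional_derivative_eq_0[OF has_derivative_mult[OF der] _ K(1), of v])
      (auto intro!: continuous_intros cont simp: K(2))
  then show "(LINT x|lborel. u x * frechet_derivative f (at x) v)
      = - (LINT x|lborel. frechet_derivative u (at x) v * f x)"
    using int1 int2 by (simp add: add_eq_0_iff)
qed

lemma integration_by_parts_d_z:
  fixes u f :: "complex ^ 'n::finite \<Rightarrow> complex"
  assumes "Ck_on (Suc i) UNIV u" "Ck_on (Suc j) UNIV f" "compact K" "\<And>x. x \<notin> K \<Longrightarrow> f x = 0"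
  shows "integrable lborel (\<lambda>x. u x * d_z k f x)"
    and "(LINT x|lborel. u x * d_z k f x) = - (LINT x|lborel. d_z k u x * f x)"
    and "integrable lborel (\<lambda>x. u x * d_zbar k f x)"
    and "(LINT x|lborel. u x * d_zbar k f x) = - (LINT x|lborel. d_zbar k u x * f x)"
proof -
  note * = integration_by_parts[OF assms]
  let ?g = "\<lambda>x v. u x * frechet_derivative f (at x) v"
  let ?h = "\<lambda>x v. frechet_derivative u (at x) v * f x"
  have uf: "u x * d_z k f x = (?g x (axis k 1) - \<i> * ?g x (axis k \<i>)) / 2"
    "u x * d_zbar k f x = (?g x (axis k 1) + \<i> * ?g x (axis k \<i>)) / 2"
    "d_z k u x * f x = (?h x (axis k 1) - \<i> * ?h x (axis k \<i>)) / 2"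
    "d_zbar k u x * f x = (?h x (axis k 1) + \<i> * ?h x (axis k \<i>)) / 2" for x
    by (simp_all add: d_z_def d_zbar_def field_simps)
  show "integrable lborel (\<lambda>x. u x * d_z k f x)"
    unfolding uf by (intro integrable_divide Bochner_Integration.integrable_diff integrable_mult_right *(1))
  show "integrable lborel (\<lambda>x. u x * d_zbar k f x)"
    unfolding uf by (intro integrable_divide Bochner_Integration.integrable_add integrable_mult_right *(1))
  show "(LINT x|lborel. u x * d_z k f x) = - (LINT x|lborel. d_z k u x * f x)"
    "(LINT x|lborel. u x * d_zbar k f x) = - (LINT x|lborel. d_zbar k u x * f x)"
    unfolding uf using *(1,2) by (simp_all add: *(3) minus_divide_left)
qed

lemma Ck_on_d_zbar:
  assumes "Ck_on (Suc k) UNIV f"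
  shows "Ck_on k UNIV (d_zbar j f)"
proof -
  have "Ck_on k UNIV (\<lambda>x. (frechet_derivative f (at x) (axis j 1)
      + \<i> * frechet_derivative f (at x) (axis j \<i>)) * (1/2))"
    using assms by (intro Ck_on_mult Ck_on_add Ck_on_const open_UNIV) auto
  then show ?thesis by (simp add: d_zbar_def[abs_def])
qed

lemma d_zbar_zero_off_support:
  assumes "Ck_on (Suc k) UNIV f" "compact K" "\<And>x. x \<notin> K \<Longrightarrow> f x = 0" "x \<notin> K"
  shows "d_zbar j f x = 0"
  using has_derivative_zero_off_support[OF compact_imp_closed[OF assms(2)] assms(3,4)
      Ck_on_Suc_has_derivative[OF assms(1)]]
  by (simp add: d_zbar_def)

section \<open>The Levi form of the averaged Gaussian weight\<close>

lemma d_z_quadratic: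
  fixes m :: "complex ^ 'n::finite"
  shows "d_z j (\<lambda>p. complex_of_real (p \<bullet> p - 2 * (p \<bullet> m) + M)) p = cnj ((p - m) $ j)"
proof -
  have "((\<lambda>p. complex_of_real (p \<bullet> p - 2 * (p \<bullet> m) + M)) has_derivative
      (\<lambda>v. complex_of_real (2 * ((p - m) \<bullet> v)))) (at p)"
    by (rule has_derivative_eq_rhs, (rule derivative_intros)+) (simp add: inner_commute inner_diff_left algebra_simps)
  note fd = frechet_derivative_at[OF this, symmetric]
  show ?thesis
    unfolding d_z_def fd by (simp add: inner_axis inner_complex_def complex_eq_iff)
qed

lemma d_zbar_cnj_component:
  fixes m :: "complex ^ 'n::finite"
  shows "d_zbar k (\<lambda>p. cnj ((p - m) $ j)) p = (if k = j then 1 else 0)"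
proof -
  have "((\<lambda>p. cnj ((p - m) $ j)) has_derivative (\<lambda>v. cnj (v $ j))) (at p)"
    by (rule has_derivative_eq_rhs, (rule derivative_intros bounded_linear.has_derivative[OF bounded_linear_cnj]
      bounded_linear.has_derivative[OF bounded_linear_vec_nth])+) simp
  note fd = frechet_derivative_at[OF this, symmetric]
  show ?thesis
    unfolding d_zbar_def fd by (simp add: axis_def)
qed

text \<open>Two integrations by parts move the derivatives from \<open>\<beta>\<close> to the weight, whose complex Hessian is the identity
  matrix: only the diagonal entries of \<open>\<beta>\<close> survive.\<close>

lemma i_ddbar_quadratic:
  fixes m :: "complex ^ 2"
  assumes "test_form \<beta>"
  shows "i_ddbar (\<lambda>p. p \<bullet> p - 2 * (p \<bullet> m) + M) \<beta> = 4 * (LINT p|lborel. \<beta> p $ 1 $ 1 + \<beta> p $ 2 $ 2)"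
proof -
  let ?K = "closure {p. \<beta> p \<noteq> 0}" and ?u = "\<lambda>p::complex^2. complex_of_real (p \<bullet> p - 2 * (p \<bullet> m) + M)"
  have K: "compact ?K" and sm: "Ck_on k UNIV \<beta>" for k
    using assms by (auto simp: test_form_def smooth_on_open_def)
  have off: "\<beta> p $ i $ j = 0" if "p \<notin> ?K" for p i j
  proof -
    have "\<beta> p = 0" using that closure_subset[of "{p. \<beta> p \<noteq> 0}"] by blast
    then show ?thesis by simp
  qed
  have comp: "Ck_on k UNIV (\<lambda>p. \<beta> p $ i $ j)" for k i j
    by (intro Ck_on_nth sm open_UNIV)
  have u: "Ck_on k UNIV ?u" for k
    by (intro Ck_on_of_real Ck_on_add Ck_on_diff Ck_on_mult Ck_on_bilinear[OF _ bounded_bilinear_inner]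
        Ck_on_const open_UNIV Ck_on_bounded_linear[OF open_UNIV bounded_linear_ident])
  have cu: "Ck_on k UNIV (\<lambda>p. cnj ((p - m) $ j))" for k j
    by (intro Ck_on_cnj Ck_on_nth Ck_on_diff Ck_on_const open_UNIV Ck_on_bounded_linear[OF open_UNIV bounded_linear_ident])
  let ?f = "\<lambda>i j p. \<beta> p $ i $ j"
  have dbar: "Ck_on (Suc 0) UNIV (d_zbar l (?f i j))" for l i j
    by (intro Ck_on_d_zbar comp)
  have dbar_off: "d_zbar l (?f i j) p = 0" if "p \<notin> ?K" for p l i j
    by (rule d_zbar_zero_off_support[OF comp[of "Suc 0"] K off that])
  have int: "integrable lborel (\<lambda>p. ?u p * d_z k (d_zbar l (?f i j)) p)" for k l i j
    by (rule integration_by_parts_d_z(1)[OF u[of "Suc 0"] dbar K dbar_off])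
  have I: "(LINT p|lborel. ?u p * d_z k (d_zbar l (?f i j)) p)
      = (if l = k then LINT p|lborel. ?f i j p else 0)" for k l i j
  proof -
    have "(LINT p|lborel. ?u p * d_z k (d_zbar l (?f i j)) p)
        = - (LINT p|lborel. d_z k ?u p * d_zbar l (?f i j) p)"
      by (rule integration_by_parts_d_z(2)[OF u[of "Suc 0"] dbar K dbar_off])
    also have "\<dots> = - (LINT p|lborel. cnj ((p - m) $ k) * d_zbar l (?f i j) p)"
      by (simp only: d_z_quadratic)
    also have "\<dots> = (LINT p|lborel. d_zbar l (\<lambda>p. cnj ((p - m) $ k)) p * ?f i j p)"
      by (subst integration_by_parts_d_z(4)[OF cu[of "Suc 0"] comp[of "Suc 0"] K off]) simp_all
    also have "\<dots> = (if l = k then LINT p|lborel. ?f i j p else 0)"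
      by (simp only: d_zbar_cnj_component) simp
    finally show ?thesis .
  qed
  have f_int: "integrable lborel (?f i j)" for i j
    by (rule integrable_continuous_compact_support[OF Ck_on_imp_continuous_on[OF comp[of 0]] K off])
  have "i_ddbar (\<lambda>p. p \<bullet> p - 2 * (p \<bullet> m) + M) \<beta> = (LINT p|lborel.
      4 * (?u p * d_z 1 (d_zbar 1 (?f 2 2)) p + ?u p * d_z 2 (d_zbar 2 (?f 1 1)) p
        - ?u p * d_z 1 (d_zbar 2 (?f 2 1)) p - ?u p * d_z 2 (d_zbar 1 (?f 1 2)) p))"
    unfolding i_ddbar_def by (simp only: distrib_left right_diff_distrib mult.left_commute)
  also have "\<dots> = 4 * ((LINT p|lborel. ?f 2 2 p) + (LINT p|lborel. ?f 1 1 p))"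
    by (simp only: integral_mult_right_zero Bochner_Integration.integral_diff Bochner_Integration.integral_add
        Bochner_Integration.integrable_diff Bochner_Integration.integrable_add int I) simp
  also have "\<dots> = 4 * (LINT p|lborel. \<beta> p $ 1 $ 1 + \<beta> p $ 2 $ 2)"
    using f_int by (simp add: add.commute)
  finally show ?thesis .
qed

lemma ball_volume_pos: "r > 0 \<Longrightarrow> measure lborel (ball (0 :: 'a::euclidean_space) r) > 0"
  using content_ball_pos by auto

lemma integrable_ball_kernel_scaleR:
  fixes h :: "complex ^ 'n::finite \<Rightarrow> 'b::{banach, second_countable_topology}"
  assumes "continuous_on UNIV h"
  shows "integrable lborel (\<lambda>w. ball_kernel r w *\<^sub>R h w)"
proof -
  have "integrable lborel (\<lambda>w. indicator (cball 0 r) w *\<^sub>R h w)"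
    using assms by (intro borel_integrable_compact) (auto intro: continuous_on_subset)
  from integrable_mult_indicator[OF _ this, of "ball 0 r"]
  have "integrable lborel (\<lambda>w. (1 / measure lborel (ball (0 :: complex ^ 'n) r)) *\<^sub>R
      (indicator (ball 0 r) w *\<^sub>R indicator (cball 0 r) w *\<^sub>R h w))"
    by (intro integrable_scaleR_right) simp
  moreover have "(1 / measure lborel (ball (0 :: complex ^ 'n) r)) *\<^sub>R
      (indicator (ball 0 r) w *\<^sub>R indicator (cball 0 r) w *\<^sub>R h w) = ball_kernel r w *\<^sub>R h w" for w
    by (auto simp: ball_kernel_def indicator_def)
  ultimately show ?thesis by (simp only:)
qed

lemma integral_ball_kernel:
  assumes "r > 0"
  shows "(LINT w|lborel. ball_kernel r (w :: complex ^ 'n::finite)) = 1"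
  using ball_volume_pos[OF assms, where 'a = "complex ^ 'n"]
  by (simp add: ball_kernel_def)

text \<open>The vector \<open>m\<close> is the barycentre of the ball; the affine correction has no complex Hessian.\<close>

lemma convolve_norm_sq_ball_kernel:
  assumes "r > 0"
  obtains m :: "complex ^ 'n::finite" and M where
    "convolve_fun (\<lambda>p. (norm p)\<^sup>2) (ball_kernel r) = (\<lambda>p. p \<bullet> p - 2 * (p \<bullet> m) + M)"
proof
  let ?k = "ball_kernel r :: complex ^ 'n \<Rightarrow> real"
  let ?m = "LINT w|lborel. ?k w *\<^sub>R w" and ?M = "LINT w|lborel. ?k w *\<^sub>R (w \<bullet> w)"
  show "convolve_fun (\<lambda>p. (norm p)\<^sup>2) ?k = (\<lambda>p. p \<bullet> p - 2 * (p \<bullet> ?m) + ?M)"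
  proof (rule ext)
    fix p :: "complex ^ 'n"
    have i1: "integrable lborel ?k" using integrable_ball_kernel_scaleR[of "\<lambda>_. 1 :: real" r] by simp
    have i2: "integrable lborel (\<lambda>w. ?k w *\<^sub>R w)" by (intro integrable_ball_kernel_scaleR continuous_intros)
    have i3: "integrable lborel (\<lambda>w. ?k w *\<^sub>R (w \<bullet> w))" by (intro integrable_ball_kernel_scaleR continuous_intros)
    have "convolve_fun (\<lambda>p. (norm p)\<^sup>2) ?k p =
        (LINT w|lborel. (p \<bullet> p) * ?k w - 2 * (p \<bullet> (?k w *\<^sub>R w)) + ?k w *\<^sub>R (w \<bullet> w))"
      unfolding convolve_fun_def
      by (intro Bochner_Integration.integral_cong)
        (auto simp: power2_norm_eq_inner inner_diff_left inner_diff_right inner_commute algebra_simps)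
    also have "\<dots> = (LINT w|lborel. (p \<bullet> p) * ?k w) - (LINT w|lborel. 2 * (p \<bullet> (?k w *\<^sub>R w))) + ?M"
      by (intro trans[OF Bochner_Integration.integral_add] arg_cong2[where f = "(+)"] refl
          Bochner_Integration.integral_diff Bochner_Integration.integrable_diff
          integrable_mult_right integrable_inner_right i1 i2 i3)
    also have "\<dots> = p \<bullet> p * (LINT w|lborel. ?k w) - 2 * (p \<bullet> ?m) + ?M"
      by (simp only: integral_mult_right_zero integral_inner_right[OF i2])
    finally show "convolve_fun (\<lambda>p. (norm p)\<^sup>2) ?k p = p \<bullet> p - 2 * (p \<bullet> ?m) + ?M"
      by (simp add: integral_ball_kernel[OF assms])
  qed
qed

lemma i_ddbar_convolve_norm_sq:
  assumes "r > 0" "test_form \<beta>"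
  shows "i_ddbar (convolve_fun (\<lambda>p. (norm p)\<^sup>2) (ball_kernel r)) \<beta>
    = 4 * (LINT p|lborel. \<beta> p $ 1 $ 1 + \<beta> p $ 2 $ 2)"
proof -
  obtain m :: "complex ^ 2" and M where
    eq: "convolve_fun (\<lambda>p. (norm p)\<^sup>2) (ball_kernel r) = (\<lambda>p. p \<bullet> p - 2 * (p \<bullet> m) + M)"
    using convolve_norm_sq_ball_kernel[OF assms(1)] by blast
  show ?thesis unfolding eq by (rule i_ddbar_quadratic[OF assms(2)])
qed

section \<open>Holomorphic change of variables\<close>

text \<open>The change of variables theorem concerns maps of the coordinate space \<open>real ^ 2\<close>; the following isometries carry
  it over to the complex plane.\<close>

definition plane_to_complex :: "real ^ 2 \<Rightarrow> complex" where
  "plane_to_complex x = Complex (x $ 1) (x $ 2)"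

definition complex_to_plane :: "complex \<Rightarrow> real ^ 2" where
  "complex_to_plane z = (\<chi> i. if i = 1 then Re z else Im z)"

lemma complex_to_plane_nth [simp]: "complex_to_plane z $ 1 = Re z" "complex_to_plane z $ 2 = Im z"
  by (simp_all add: complex_to_plane_def)

lemma plane_inverses [simp]:
  "complex_to_plane (plane_to_complex x) = x" "plane_to_complex (complex_to_plane z) = z"
  by (simp_all add: vec_eq_iff forall_2 plane_to_complex_def)

lemma bounded_linear_plane_to_complex: "bounded_linear plane_to_complex"
  unfolding linear_conv_bounded_linear[symmetric]
  by (rule linearI) (simp_all add: plane_to_complex_def complex_eq_iff)

lemma bounded_linear_complex_to_plane: "bounded_linear complex_to_plane"
  unfolding linear_conv_bounded_linear[symmetric]
  by (rule linearI) (simp_all add: vec_eq_iff forall_2)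

lemma measurable_plane_to_complex [measurable]: "plane_to_complex \<in> borel_measurable borel"
  by (intro borel_measurable_continuous_onI linear_continuous_on bounded_linear_plane_to_complex)

lemma measurable_complex_to_plane [measurable]: "complex_to_plane \<in> borel_measurable borel"
  by (intro borel_measurable_continuous_onI linear_continuous_on bounded_linear_complex_to_plane)

lemma distr_plane_to_complex: "distr lborel borel plane_to_complex = lborel"
proof (rule lborel_eqI[symmetric])
  fix l u :: complex
  assume le: "\<And>b. b \<in> Basis \<Longrightarrow> l \<bullet> b \<le> u \<bullet> b"
  have "plane_to_complex -` box l u = box (complex_to_plane l) (complex_to_plane u)"
    by (auto simp: plane_to_complex_def in_box_complex_iff mem_box_cart forall_2)
  moreover have "Re l \<le> Re u" "Im l \<le> Im u"
    using le[of 1] le[of \<i>] by (auto simp: Basis_complex_def inner_complex_def)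
  moreover have "(\<Prod>b\<in>Basis. (u - l) \<bullet> b) = (Re u - Re l) * (Im u - Im l)"
    by (simp add: Basis_complex_def inner_complex_def)
  moreover have "complex_to_plane l $ i \<le> complex_to_plane u $ i" for i
    using exhaust_2[of i] calculation(2,3) by auto
  moreover have "emeasure lborel (box (complex_to_plane l) (complex_to_plane u))
      = (\<Prod>b\<in>Basis. (complex_to_plane u - complex_to_plane l) \<bullet> b)"
    using calculation(5)
    by (subst emeasure_lborel_box) (auto simp: Basis_vec_def inner_axis)
  moreover have "(\<Prod>b\<in>Basis. (complex_to_plane u - complex_to_plane l) \<bullet> b)
     = (Re u - Re l) * (Im u - Im l)"
  proof -
    have B: "(Basis :: (real ^ 2) set) = {axis 1 1, axis 2 1}"
      by (auto simp: Basis_vec_def UNIV_2)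
    have "axis 1 1 \<noteq> (axis 2 1 :: real ^ 2)" by (simp add: axis_eq_axis)
    then show ?thesis by (subst B) (simp add: inner_axis)
  qed
  ultimately show "emeasure (distr lborel borel plane_to_complex) (box l u) = (\<Prod>b\<in>Basis. (u - l) \<bullet> b)"
    by (subst emeasure_distr) auto
qed simp

text \<open>The Jacobian determinant of multiplication by \<open>\<phi>'\<close> is \<open>\<bar>\<phi>'\<bar>\<^sup>2\<close>.\<close>

lemma integral_holomorphic_change_of_variables:
  fixes f :: "complex \<Rightarrow> complex"
  assumes U: "open U" and hol: "\<phi> holomorphic_on U" and inj: "inj_on \<phi> U" and im: "open (\<phi> ` U)"
    and f: "continuous_on UNIV f" "compact K" "\<And>z. z \<notin> K \<Longrightarrow> f z = 0"
  shows "(LINT w:U|lborel. (norm (deriv \<phi> w))\<^sup>2 *\<^sub>R f (\<phi> w)) = (LINT z:\<phi> ` U|lborel. f z)"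
proof -
  note [measurable] = borel_measurable_continuous_onI[OF f(1)]
  define S where "S = plane_to_complex -` U"
  define g where "g x = complex_to_plane (\<phi> (plane_to_complex x))" for x
  define g' where "g' x v = complex_to_plane (deriv \<phi> (plane_to_complex x) * plane_to_complex v)" for x v
  define F where "F x = complex_to_plane (f (plane_to_complex x))" for x
  have pc: "continuous_on A plane_to_complex" for A
    by (intro linear_continuous_on bounded_linear_plane_to_complex)
  have cp: "continuous_on A complex_to_plane" for A
    by (intro linear_continuous_on bounded_linear_complex_to_plane)
  have S: "open S" unfolding S_def by (rule open_vimage[OF U pc])
  have gS: "g ` S = plane_to_complex -` (\<phi> ` U)"
  proof -
    have "g ` S \<subseteq> plane_to_complex -` (\<phi> ` U)" by (auto simp: g_def S_def)
    moreover have "x \<in> g ` S" if x: "plane_to_complex x \<in> \<phi> ` U" for x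
    proof -
      obtain w where "w \<in> U" "plane_to_complex x = \<phi> w" using x by blast
      then show ?thesis
        by (intro image_eqI[of _ _ "complex_to_plane w"]) (auto simp: g_def S_def simp flip: \<open>plane_to_complex x = \<phi> w\<close>)
    qed
    ultimately show ?thesis by auto
  qed
  have gS_open: "open (g ` S)" unfolding gS by (rule open_vimage[OF im pc])
  have inj_g: "inj_on g S"
  proof (rule inj_onI)
    fix x y assume "x \<in> S" "y \<in> S" "g x = g y"
    then have "\<phi> (plane_to_complex x) = \<phi> (plane_to_complex y)" unfolding g_def by (metis plane_inverses(2))
    then have "plane_to_complex x = plane_to_complex y"
      using \<open>x \<in> S\<close> \<open>y \<in> S\<close> inj by (auto simp: S_def dest: inj_onD)
    then show "x = y" by (metis plane_inverses(1))
  qed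
  have der: "(g has_derivative g' x) (at x within S)" if "x \<in> S" for x
  proof -
    have "(\<phi> has_field_derivative deriv \<phi> (plane_to_complex x)) (at (plane_to_complex x))"
      using that hol U by (intro holomorphic_derivI[of _ U]) (auto simp: S_def)
    then have "((\<lambda>x. \<phi> (plane_to_complex x)) has_derivative (\<lambda>v. deriv \<phi> (plane_to_complex x) * plane_to_complex v)) (at x within S)"
      using has_derivative_compose[OF bounded_linear_imp_has_derivative[OF bounded_linear_plane_to_complex]]
      by (auto simp: has_field_derivative_def)
    then show ?thesis unfolding g_def[abs_def] g'_def[abs_def]
      by (rule bounded_linear.has_derivative[OF bounded_linear_complex_to_plane])
  qed
  have det: "\<bar>det (matrix (g' x))\<bar> = (norm (deriv \<phi> (plane_to_complex x)))\<^sup>2" for x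
  proof -
    let ?d = "deriv \<phi> (plane_to_complex x)"
    have "det (matrix (g' x)) = Re ?d * Re ?d + Im ?d * Im ?d"
      by (simp add: det_2 matrix_def g'_def plane_to_complex_def axis_def)
    also have "\<dots> = (norm ?d)\<^sup>2" by (simp only: cmod_power2) (simp only: power2_eq_square)
    finally show ?thesis by simp
  qed
  have F: "integrable lborel F"
  proof (rule integrable_continuous_compact_support)
    show "continuous_on UNIV F"
      unfolding F_def by (intro continuous_on_compose2[OF cp] continuous_on_compose2[OF f(1)] pc) auto
    show "compact (complex_to_plane ` K)" by (rule compact_continuous_image[OF cp f(2)])
    show "F x = 0" if "x \<notin> complex_to_plane ` K" for x
    proof -
      have "plane_to_complex x \<notin> K" using that by (metis imageI plane_inverses(1))
      then show ?thesis by (simp add: F_def f(3) vec_eq_iff forall_2)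
    qed
  qed
  have F_int: "set_integrable lborel (g ` S) F"
    unfolding set_integrable_def using gS_open by (intro integrable_mult_indicator F) auto
  have F_abs: "F absolutely_integrable_on g ` S"
    using F_int unfolding set_integrable_def by (subst integrable_completion) auto
  let ?D = "\<lambda>x. \<bar>det (matrix (g' x))\<bar> *\<^sub>R F (g x)"
  have cov: "?D absolutely_integrable_on S" "integral S ?D = integral (g ` S) F"
    using has_absolute_integral_change_of_variables[OF _ der inj_g, of F "integral (g ` S) F"] F_abs S by auto
  let ?H = "\<lambda>w. indicator U w *\<^sub>R ((norm (deriv \<phi> w))\<^sup>2 *\<^sub>R f (\<phi> w))"
  have H [measurable]: "?H \<in> borel_measurable borel"
  proof -
    have "continuous_on U (\<lambda>w. (norm (deriv \<phi> w))\<^sup>2 *\<^sub>R f (\<phi> w))"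
      using hol U by (intro continuous_intros continuous_on_compose2[OF f(1)] holomorphic_on_imp_continuous_on
          holomorphic_deriv) auto
    then show ?thesis using U by (intro borel_measurable_continuous_on_indicator) auto
  qed
  have ind: "indicator S x *\<^sub>R ?D x = complex_to_plane (?H (plane_to_complex x))" for x
    by (auto simp: indicator_def S_def det F_def g_def vec_eq_iff forall_2)
  have D_meas: "(\<lambda>x. indicator S x *\<^sub>R ?D x) \<in> borel_measurable lborel"
    unfolding ind
    using measurable_compose[OF measurable_compose[OF measurable_plane_to_complex H] measurable_complex_to_plane]
    by simp
  have D_int: "set_integrable lborel S ?D"
    using cov(1) D_meas unfolding set_integrable_def by (simp add: integrable_completion)
  have "(LINT w:U|lborel. (norm (deriv \<phi> w))\<^sup>2 *\<^sub>R f (\<phi> w)) = (LINT w|distr lborel borel plane_to_complex. ?H w)"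
    by (simp add: set_lebesgue_integral_def distr_plane_to_complex)
  also have "\<dots> = (LINT x|lborel. plane_to_complex (indicator S x *\<^sub>R ?D x))"
    by (subst integral_distr) (auto simp: ind simp del: scaleR_scaleR)
  also have "\<dots> = plane_to_complex (LINT x:S|lborel. ?D x)"
    using D_int unfolding set_integrable_def set_lebesgue_integral_def
    by (rule integral_bounded_linear[OF bounded_linear_plane_to_complex])
  also have "(LINT x:S|lborel. ?D x) = (LINT x:g ` S|lborel. F x)"
    using set_borel_integral_eq_integral(2)[OF D_int] set_borel_integral_eq_integral(2)[OF F_int] cov(2) by simp
  also have "plane_to_complex \<dots> = (LINT x|lborel. plane_to_complex (indicator (g ` S) x *\<^sub>R F x))"
    using F_int unfolding set_integrable_def set_lebesgue_integral_def
    by (rule integral_bounded_linear[OF bounded_linear_plane_to_complex, symmetric])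
  also have "\<dots> = (LINT x|lborel. (\<lambda>z. indicator (\<phi> ` U) z *\<^sub>R f z) (plane_to_complex x))"
    unfolding gS by (intro Bochner_Integration.integral_cong)
      (auto simp: F_def indicator_def plane_to_complex_def complex_eq_iff)
  also have "\<dots> = (LINT z|distr lborel borel plane_to_complex. indicator (\<phi> ` U) z *\<^sub>R f z)"
    using im by (subst integral_distr) auto
  also have "\<dots> = (LINT z:\<phi> ` U|lborel. f z)"
    by (simp add: set_lebesgue_integral_def distr_plane_to_complex)
  finally show ?thesis .
qed

section \<open>The current of integration over a polynomial graph\<close>

text \<open>The coefficient, with respect to Lebesgue measure, of the pullback of \<open>\<beta>\<close> by the standard parametrization of
  the graph, whose tangent vector is \<open>(1, P')\<close>.\<close>

definition graph_density :: "complex poly \<Rightarrow> form11 \<Rightarrow> complex \<Rightarrow> complex" where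
  "graph_density P \<beta> z = 2 * (\<Sum>j\<in>UNIV. \<Sum>k\<in>UNIV. \<beta> (graph_point P z) $ j $ k *
     vec2 1 (poly (pderiv P) z) $ j * cnj (vec2 1 (poly (pderiv P) z) $ k))"

lemma continuous_on_graph_density:
  assumes "continuous_on UNIV \<beta>"
  shows "continuous_on UNIV (graph_density P \<beta>)"
proof -
  have "continuous_on UNIV (\<lambda>z. \<beta> (graph_point P z))"
    by (intro continuous_on_compose2[OF assms] continuous_intros) auto
  then show ?thesis
    unfolding graph_density_def[abs_def] sum_2 vec2_nth by (intro continuous_intros)
qed

lemma graph_density_scaleR:
  "graph_density P (\<lambda>p. \<rho> p *\<^sub>R \<beta> p) z = of_real (\<rho> (graph_point P z)) * graph_density P \<beta> z"
  by (simp add: graph_density_def sum_2 scaleR_conv_of_real[where 'a = complex] algebra_simps)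

lemma integrable_graph_density:
  assumes "continuous_on UNIV \<beta>" "compact K" "\<And>p. p \<in> poly_graph P - K \<Longrightarrow> \<beta> p = 0"
  shows "integrable lborel (graph_density P \<beta>)"
    and "\<exists>K'. compact K' \<and> (\<forall>z. z \<notin> K' \<longrightarrow> graph_density P \<beta> z = 0)"
proof -
  have K': "compact ((\<lambda>p. p $ 1) ` K)"
    by (intro compact_continuous_image continuous_intros assms(2))
  have off: "graph_density P \<beta> z = 0" if "z \<notin> (\<lambda>p. p $ 1) ` K" for z
  proof -
    have "graph_point P z \<notin> K" using that by (metis graph_point_nth(1) imageI)
    then have "\<beta> (graph_point P z) = 0" by (intro assms(3)) (auto simp: poly_graph_eq_range)
    then show ?thesis by (simp add: graph_density_def)
  qed
  show "integrable lborel (graph_density P \<beta>)"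
    by (rule integrable_continuous_compact_support[OF continuous_on_graph_density[OF assms(1)] K' off])
  show "\<exists>K'. compact K' \<and> (\<forall>z. z \<notin> K' \<longrightarrow> graph_density P \<beta> z = 0)" using K' off by blast
qed

lemma local_parametrization_graph_point: "local_parametrization (poly_graph P) UNIV (graph_point P)"
  unfolding local_parametrization_def
proof (intro conjI allI ballI)
  show "(\<lambda>w. graph_point P w $ j) holomorphic_on UNIV" for j
    using exhaust_2[of j] by (auto intro!: holomorphic_intros)
  show "\<exists>j. deriv (\<lambda>w. graph_point P w $ j) w \<noteq> 0" for w
    by (intro exI[of _ 1]) simp
  show "openin (top_of_set (poly_graph P)) (graph_point P ` UNIV)"
    by (simp add: poly_graph_eq_range)
  show "\<exists>\<delta>. homeomorphism UNIV (graph_point P ` UNIV) (graph_point P) \<delta>"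
    by (intro exI[of _ "\<lambda>p. p $ 1"]) (auto simp: homeomorphism_def intro!: continuous_intros image_eqI)
qed simp

lemma pullback_integral_graph_point:
  "pullback_integral UNIV (graph_point P) \<beta> = (LINT z|lborel. graph_density P \<beta> z)"
proof -
  have "deriv (\<lambda>w. graph_point P w $ j) z = vec2 1 (poly (pderiv P) z) $ j" for j z
    using exhaust_2[of j] by (auto intro!: DERIV_imp_deriv poly_DERIV)
  then show ?thesis
    by (simp add: pullback_integral_def set_lebesgue_integral_def graph_density_def[abs_def])
qed

text \<open>The first coordinate of a parametrization of the graph is an injective holomorphic function, so
  that a change of variables reduces every parametrization to the standard one.\<close>

lemma pullback_integral_poly_graph:
  assumes par: "local_parametrization (poly_graph P) U \<gamma>"
    and \<beta>: "continuous_on UNIV \<beta>"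
    and K: "compact K" "K \<subseteq> \<gamma> ` U" "\<And>p. p \<in> poly_graph P - K \<Longrightarrow> \<beta> p = 0"
  shows "pullback_integral U \<gamma> \<beta> = (LINT z|lborel. graph_density P \<beta> z)"
proof -
  define \<phi> where "\<phi> w = \<gamma> w $ 1" for w
  have U: "open U" and hol: "\<phi> holomorphic_on U" and
    op: "openin (top_of_set (poly_graph P)) (\<gamma> ` U)" and inj: "inj_on \<gamma> U"
    using par by (auto simp: local_parametrization_def \<phi>_def[abs_def] homeomorphism_def intro: inj_on_inverseI)
  have \<gamma>: "\<gamma> w = graph_point P (\<phi> w)" if "w \<in> U" for w
  proof -
    have "\<gamma> w \<in> poly_graph P" using openin_imp_subset[OF op] that by blast
    then show ?thesis by (auto simp: \<phi>_def poly_graph_eq_range)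
  qed
  have inj_\<phi>: "inj_on \<phi> U"
  proof (rule inj_onI)
    fix x y assume "x \<in> U" "y \<in> U" "\<phi> x = \<phi> y"
    then show "x = y" using \<gamma> inj by (metis inj_onD)
  qed
  have im: "open (\<phi> ` U)"
  proof -
    obtain V where V: "open V" "\<gamma> ` U = poly_graph P \<inter> V" using op by (auto simp: openin_open)
    have "z \<in> \<phi> ` U \<longleftrightarrow> graph_point P z \<in> V" for z
    proof
      assume "z \<in> \<phi> ` U"
      then show "graph_point P z \<in> V" using \<gamma> V(2) by (metis IntD2 image_iff)
    next
      assume "graph_point P z \<in> V"
      then have "graph_point P z \<in> \<gamma> ` U" unfolding V(2) by (auto simp: poly_graph_eq_range)
      then obtain w where "w \<in> U" "graph_point P z = \<gamma> w" by blast
      then show "z \<in> \<phi> ` U" using graph_point_nth(1)[of P z] by (metis \<phi>_def imageI)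
    qed
    then have "\<phi> ` U = graph_point P -` V" by auto
    moreover have "open (graph_point P -` V)"
      by (intro open_vimage[OF V(1)] continuous_intros)
    ultimately show ?thesis by simp
  qed
  obtain K' where K': "compact K'" "\<And>z. z \<notin> K' \<Longrightarrow> graph_density P \<beta> z = 0"
    using integrable_graph_density(2)[OF \<beta> K(1,3)] by blast
  have dj: "deriv (\<lambda>w. \<gamma> w $ j) w = vec2 1 (poly (pderiv P) (\<phi> w)) $ j * deriv \<phi> w" if w: "w \<in> U" for j w
  proof (cases "j = 1")
    case False
    have "((\<lambda>w. poly P (\<phi> w)) has_field_derivative poly (pderiv P) (\<phi> w) * deriv \<phi> w) (at w)"
      by (rule DERIV_chain2[OF poly_DERIV holomorphic_derivI[OF hol U w]])
    then have "((\<lambda>w. \<gamma> w $ j) has_field_derivative poly (pderiv P) (\<phi> w) * deriv \<phi> w) (at w)"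
      by (rule has_field_derivative_transform_within_open[OF _ U w]) (use \<gamma> False exhaust_2[of j] in auto)
    then show ?thesis using False exhaust_2[of j] by (auto intro: DERIV_imp_deriv)
  qed (simp add: \<phi>_def[abs_def])
  have "pullback_integral U \<gamma> \<beta> = (LINT w:U|lborel. (norm (deriv \<phi> w))\<^sup>2 *\<^sub>R graph_density P \<beta> (\<phi> w))"
    unfolding pullback_integral_def
  proof (rule set_lebesgue_integral_cong)
    show "\<forall>w. w \<in> U \<longrightarrow> 2 * (\<Sum>j\<in>UNIV. \<Sum>k\<in>UNIV. \<beta> (\<gamma> w) $ j $ k * deriv (\<lambda>w. \<gamma> w $ j) w * cnj (deriv (\<lambda>w. \<gamma> w $ k) w))
        = (norm (deriv \<phi> w))\<^sup>2 *\<^sub>R graph_density P \<beta> (\<phi> w)"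
    proof (intro allI impI)
      fix w assume w: "w \<in> U"
      have "of_real ((norm (deriv \<phi> w))\<^sup>2) = deriv \<phi> w * cnj (deriv \<phi> w)" by (rule complex_norm_square)
      then show "2 * (\<Sum>j\<in>UNIV. \<Sum>k\<in>UNIV. \<beta> (\<gamma> w) $ j $ k * deriv (\<lambda>w. \<gamma> w $ j) w * cnj (deriv (\<lambda>w. \<gamma> w $ k) w))
        = (norm (deriv \<phi> w))\<^sup>2 *\<^sub>R graph_density P \<beta> (\<phi> w)"
        unfolding graph_density_def dj[OF w] \<gamma>[OF w] scaleR_conv_of_real
        by (simp only: sum_2 vec2_nth complex_cnj_mult algebra_simps)
    qed
  qed (use U in simp)
  also have "\<dots> = (LINT z:\<phi> ` U|lborel. graph_density P \<beta> z)"
    by (rule integral_holomorphic_change_of_variables[OF U hol inj_\<phi> im continuous_on_graph_density[OF \<beta>] K'])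
  also have "\<dots> = (LINT z|lborel. graph_density P \<beta> z)"
    unfolding set_lebesgue_integral_def
  proof (rule Bochner_Integration.integral_cong[OF refl])
    fix z
    show "indicator (\<phi> ` U) z *\<^sub>R graph_density P \<beta> z = graph_density P \<beta> z"
    proof (cases "z \<in> \<phi> ` U")
      case False
      have "graph_point P z \<notin> K"
      proof
        assume "graph_point P z \<in> K"
        then obtain w where "w \<in> U" "\<gamma> w = graph_point P z" using K(2) by (metis imageE subsetD)
        then show False using False graph_point_nth(1)[of P z] by (metis \<phi>_def imageI)
      qed
      then have "\<beta> (graph_point P z) = 0" by (intro K(3)) (auto simp: poly_graph_eq_range)
      then show ?thesis by (simp add: graph_density_def)
    qed simp
  qed
  finally show ?thesis .
qed

text \<open>Once each piece is rewritten in the standard parametrization, the pieces add up pointwise because the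
  partition functions sum to 1 on the support of \<open>\<beta>\<close>.\<close>

theorem integration_current_poly_graph:
  assumes \<beta>: "continuous_on UNIV \<beta>" and K: "compact (closure {p. \<beta> p \<noteq> 0})"
  shows "integration_current (poly_graph P) \<beta> = (LINT z|lborel. graph_density P \<beta> z)"
  unfolding integration_current_def
proof (rule the_equality)
  let ?K = "closure {p. \<beta> p \<noteq> 0}"
  have off: "\<beta> p = 0" if "p \<notin> ?K" for p
    using that closure_subset[of "{p. \<beta> p \<noteq> 0}"] by blast
  have "Ck_on k UNIV (\<lambda>p :: complex ^ 2. 1 :: real)" for k
    by (rule Ck_on_const[OF open_UNIV])
  then have smooth: "smooth_on_open UNIV (\<lambda>p :: complex ^ 2. 1 :: real)"
    unfolding smooth_on_open_def by blast
  have "compact (poly_graph P \<inter> ?K)" by (rule closed_Int_compact[OF closed_poly_graph K])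
  moreover have "poly_graph P \<inter> ?K \<subseteq> graph_point P ` UNIV" by (simp add: poly_graph_eq_range)
  moreover have "\<forall>p\<in>poly_graph P - poly_graph P \<inter> ?K. 1 *\<^sub>R \<beta> p = 0"
  proof
    fix p assume "p \<in> poly_graph P - poly_graph P \<inter> ?K"
    then have "p \<notin> ?K" by blast
    from off[OF this] show "1 *\<^sub>R \<beta> p = 0" by (simp only: scaleR_zero_right)
  qed
  ultimately have supp: "\<exists>K. compact K \<and> K \<subseteq> graph_point P ` UNIV \<and> (\<forall>p\<in>poly_graph P - K. 1 *\<^sub>R \<beta> p = 0)"
    by blast
  show "has_form_integral (poly_graph P) \<beta> (LINT z|lborel. graph_density P \<beta> z)"
    unfolding has_form_integral_def
  proof (rule exI[of _ "1 :: nat"], rule exI[of _ "\<lambda>_. UNIV"], rule exI[of _ "\<lambda>_. graph_point P"],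
      rule exI[of _ "\<lambda>_ _. 1"], intro conjI allI impI local_parametrization_graph_point smooth supp)
    show "(LINT z|lborel. graph_density P \<beta> z) =
        (\<Sum>i<1::nat. pullback_integral UNIV (graph_point P) (\<lambda>p. 1 *\<^sub>R \<beta> p))"
      by (simp add: pullback_integral_graph_point)
  qed simp_all
  fix I assume "has_form_integral (poly_graph P) \<beta> I"
  then obtain N :: nat and U \<gamma> and \<rho> :: "nat \<Rightarrow> complex ^ 2 \<Rightarrow> real" where
    loc: "\<And>i. i < N \<Longrightarrow> local_parametrization (poly_graph P) (U i) (\<gamma> i) \<and>
               smooth_on_open UNIV (\<rho> i) \<and> (\<forall>p. 0 \<le> \<rho> i p) \<and>
               (\<exists>K. compact K \<and> K \<subseteq> \<gamma> i ` U i \<and> (\<forall>p\<in>poly_graph P - K. \<rho> i p *\<^sub>R \<beta> p = 0))"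
    and one: "\<And>p. p \<in> poly_graph P \<inter> ?K \<Longrightarrow> (\<Sum>i<N. \<rho> i p) = 1"
    and I: "I = (\<Sum>i<N. pullback_integral (U i) (\<gamma> i) (\<lambda>p. \<rho> i p *\<^sub>R \<beta> p))"
    unfolding has_form_integral_def by blast
  have cont: "continuous_on UNIV (\<lambda>p. \<rho> i p *\<^sub>R \<beta> p)" if "i < N" for i
  proof -
    have "Ck_on 0 UNIV (\<rho> i)" using loc[OF that] unfolding smooth_on_open_def by blast
    then show ?thesis by (intro continuous_on_scaleR \<beta>) simp
  qed
  have "I = (\<Sum>i<N. (LINT z|lborel. graph_density P (\<lambda>p. \<rho> i p *\<^sub>R \<beta> p) z))"
    unfolding I
  proof (rule sum.cong[OF refl])
    fix i assume "i \<in> {..<N}"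
    then have i: "i < N" by simp
    have par: "local_parametrization (poly_graph P) (U i) (\<gamma> i)"
      and ex: "\<exists>L. compact L \<and> L \<subseteq> \<gamma> i ` U i \<and> (\<forall>p\<in>poly_graph P - L. \<rho> i p *\<^sub>R \<beta> p = 0)"
      using loc[OF i] by simp_all
    from ex obtain L where L: "compact L" "L \<subseteq> \<gamma> i ` U i" "\<forall>p\<in>poly_graph P - L. \<rho> i p *\<^sub>R \<beta> p = 0"
      by (elim exE conjE)
    show "pullback_integral (U i) (\<gamma> i) (\<lambda>p. \<rho> i p *\<^sub>R \<beta> p)
        = (LINT z|lborel. graph_density P (\<lambda>p. \<rho> i p *\<^sub>R \<beta> p) z)"
      by (rule pullback_integral_poly_graph[OF par cont[OF i] L(1,2) bspec[OF L(3)]])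
  qed
  also have "\<dots> = (LINT z|lborel. (\<Sum>i<N. graph_density P (\<lambda>p. \<rho> i p *\<^sub>R \<beta> p) z))"
  proof (rule Bochner_Integration.integral_sum[symmetric])
    fix i assume "i \<in> {..<N}"
    then have i: "i < N" by simp
    have "\<rho> i p *\<^sub>R \<beta> p = 0" if "p \<in> poly_graph P - ?K" for p
    proof -
      have "\<beta> p = 0" by (rule off) (use that in blast)
      then show ?thesis by (rule ssubst) (rule scaleR_zero_right)
    qed
    then show "integrable lborel (graph_density P (\<lambda>p. \<rho> i p *\<^sub>R \<beta> p))"
      by (rule integrable_graph_density(1)[OF cont[OF i] K])
  qed
  also have "\<dots> = (LINT z|lborel. graph_density P \<beta> z)"
  proof (rule Bochner_Integration.integral_cong[OF refl])
    fix z
    show "(\<Sum>i<N. graph_density P (\<lambda>p. \<rho> i p *\<^sub>R \<beta> p) z) = graph_density P \<beta> z"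
    proof (cases "\<beta> (graph_point P z) = 0")
      case True
      then show ?thesis by (simp add: graph_density_def)
    next
      case False
      then have "graph_point P z \<in> poly_graph P \<inter> ?K"
        using off[of "graph_point P z"] unfolding poly_graph_eq_range by blast
      then have "(\<Sum>i<N. \<rho> i (graph_point P z)) = 1" by (rule one)
      from arg_cong[OF this, of complex_of_real] show ?thesis
        by (simp only: graph_density_scaleR of_real_sum sum_distrib_right[symmetric] of_real_1 mult_1)
    qed
  qed
  finally show "I = (LINT z|lborel. graph_density P \<beta> z)" .
qed

section \<open>Area growth of a polynomial graph\<close>

text \<open>A continuously differentiable substitute for \<open>R ^ 4\<close> times the indicator of the disc of radius \<open>R\<close>, supported in
  the disc of radius \<open>2 R\<close>; the gradient of \<open>bump R\<close> at \<open>w\<close> is \<open>bump_slope R w\<close> times \<open>w\<close>.\<close>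

definition bump :: "real \<Rightarrow> complex \<Rightarrow> real" where
  "bump R w = (max 0 (4 * R\<^sup>2 - w \<bullet> w))\<^sup>2"

definition bump_slope :: "real \<Rightarrow> complex \<Rightarrow> real" where
  "bump_slope R w = - 4 * max 0 (4 * R\<^sup>2 - w \<bullet> w)"

lemma DERIV_max_0_square: "((\<lambda>s::real. (max 0 s)\<^sup>2) has_field_derivative 2 * max 0 s) (at s)"
proof (cases s "0 :: real" rule: linorder_cases)
  case less
  then have "((\<lambda>s::real. 0) has_field_derivative 2 * max 0 s) (at s)" by simp
  then show ?thesis
    by (rule has_field_derivative_transform_within_open[of _ _ _ "{..<0}"]) (use less in auto)
next
  case greater
  then have "((\<lambda>s::real. s\<^sup>2) has_field_derivative 2 * max 0 s) (at s)"
    by (auto intro!: derivative_eq_intros)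
  then show ?thesis
    by (rule has_field_derivative_transform_within_open[of _ _ _ "{0<..}"]) (use greater in auto)
next
  case equal
  have "(\<lambda>h. (max 0 h)\<^sup>2 / h) \<midarrow>0\<rightarrow> (0::real)"
  proof (rule tendsto_sandwich[of "\<lambda>h. - \<bar>h\<bar>" _ _ "\<lambda>h. \<bar>h\<bar>"])
    show "\<forall>\<^sub>F h in at (0::real). - \<bar>h\<bar> \<le> (max 0 h)\<^sup>2 / h" "\<forall>\<^sub>F h in at (0::real). (max 0 h)\<^sup>2 / h \<le> \<bar>h\<bar>"
      by (auto intro!: always_eventually simp: max_def power2_eq_square)
  qed (auto intro!: tendsto_eq_intros)
  then show ?thesis using equal by (simp add: DERIV_def)
qed

lemma has_derivative_bump:
  "(bump R has_derivative (\<lambda>v. bump_slope R w * (w \<bullet> v))) (at w)"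
proof -
  have "((\<lambda>w. 4 * R\<^sup>2 - w \<bullet> w) has_derivative (\<lambda>v. - 2 * (w \<bullet> v))) (at w)"
    by (rule has_derivative_eq_rhs, (rule derivative_intros)+) (simp add: inner_commute)
  from has_derivative_compose[OF this DERIV_max_0_square[unfolded has_field_derivative_def]]
  show ?thesis by (simp add: bump_def[abs_def] bump_slope_def mult.assoc)
qed

lemma continuous_on_bump [continuous_intros]:
  "continuous_on S f \<Longrightarrow> continuous_on S (\<lambda>x. bump R (f x))"
  "continuous_on S f \<Longrightarrow> continuous_on S (\<lambda>x. bump_slope R (f x))"
  unfolding bump_def bump_slope_def by (intro continuous_intros; assumption)+

lemma bump_nonneg [simp]: "bump R w \<ge> 0"
  by (simp add: bump_def)

lemma bump_zero: "norm w \<ge> 2 * R \<Longrightarrow> R \<ge> 0 \<Longrightarrow> bump R w = 0"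
  using power_mono[of "2 * R" "norm w" 2]
  by (simp add: bump_def power2_norm_eq_inner power_mult_distrib max_def)

lemma bump_le: "bump R w \<le> 16 * R ^ 4"
proof -
  have "(max 0 (4 * R\<^sup>2 - w \<bullet> w))\<^sup>2 \<le> (4 * R\<^sup>2)\<^sup>2"
    by (intro power_mono) auto
  then show ?thesis by (simp add: bump_def power_mult_distrib)
qed

lemma bump_ge: "norm w < R \<Longrightarrow> bump R w \<ge> R ^ 4"
proof -
  assume w: "norm w < R"
  have "(norm w)\<^sup>2 \<le> R\<^sup>2" using w by (intro power_mono) auto
  then have "(R\<^sup>2)\<^sup>2 \<le> (max 0 (4 * R\<^sup>2 - w \<bullet> w))\<^sup>2"
    by (intro power_mono) (auto simp: power2_norm_eq_inner)
  then show ?thesis by (simp add: bump_def)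
qed

lemma compact_poly_sublevel:
  fixes P :: "complex poly"
  assumes "degree P > 0"
  shows "compact {z. norm (poly P z) \<le> M}"
  unfolding compact_eq_bounded_closed
proof
  obtain K where K: "K > 0" "\<And>z. (1 + norm z) ^ degree P \<le> K * (1 + norm (poly P z))"
    using power_le_poly_norm[of P] assms by fastforce
  have "norm z \<le> K * (1 + M)" if "norm (poly P z) \<le> M" for z
  proof -
    have "1 + norm z \<le> (1 + norm z) ^ degree P" using assms by (intro self_le_power) auto
    also have "\<dots> \<le> K * (1 + norm (poly P z))" by (rule K(2))
    also have "\<dots> \<le> K * (1 + M)" using K(1) that by (intro mult_left_mono) auto
    finally show ?thesis by simp
  qed
  then show "bounded {z. norm (poly P z) \<le> M}" by (auto simp: bounded_iff)
  show "closed {z. norm (poly P z) \<le> M}" by (intro closed_Collect_le continuous_intros)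
qed

text \<open>Up to the factor \<open>R ^ 4\<close>, the area of the discs around \<open>c\<close> of radius about \<open>R\<close>, counted with the multiplicity with
  which \<open>P\<close> covers them.\<close>

definition smoothed_area :: "complex poly \<Rightarrow> real \<Rightarrow> complex \<Rightarrow> real" where
  "smoothed_area P R c = (LINT z|lborel. bump R (poly P z - c) * (norm (poly (pderiv P) z))\<^sup>2)"

lemma smoothed_area_support:
  assumes "R \<ge> 0" "bump R (poly P z - c) \<noteq> 0"
  shows "norm (poly P z) \<le> 2 * R + norm c"
proof -
  have "norm (poly P z - c) \<le> 2 * R" using bump_zero[of R "poly P z - c"] assms by force
  then show ?thesis using norm_triangle_sub[of "poly P z" c] by simp
qed

lemma smoothed_area_integrable:
  assumes "degree P > 0" "R \<ge> 0"
  shows "integrable lborel (\<lambda>z. bump R (poly P z - c) * (norm (poly (pderiv P) z))\<^sup>2)"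
proof (rule integrable_continuous_compact_support)
  show "continuous_on UNIV (\<lambda>z. bump R (poly P z - c) * (norm (poly (pderiv P) z))\<^sup>2)"
    by (intro continuous_intros)
  show "compact {z. norm (poly P z) \<le> 2 * R + norm c}" by (rule compact_poly_sublevel[OF assms(1)])
  show "bump R (poly P z - c) * (norm (poly (pderiv P) z))\<^sup>2 = 0"
    if "z \<notin> {z. norm (poly P z) \<le> 2 * R + norm c}" for z
    using smoothed_area_support[OF assms(2), of P z c] that by auto
qed

text \<open>The integrand is the divergence of the compactly supported vector field \<open>bump R (P - b) \<cdot> c \<cdot> cnj P'\<close>: the field
  \<open>c \<cdot> cnj P'\<close> is antiholomorphic, hence divergence free, and \<open>P'\<close> maps it to \<open>\<bar>P'\<bar>\<^sup>2 c\<close>.\<close>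

lemma integral_bump_slope_eq_0:
  assumes P: "degree P > 0" and R: "R \<ge> 0"
  shows "(LINT z|lborel. bump_slope R (poly P z - b) * ((poly P z - b) \<bullet> c) * (norm (poly (pderiv P) z))\<^sup>2) = 0"
proof -
  define p p' p'' where "p z = poly P z - b" "p' z = poly (pderiv P) z" "p'' z = poly (pderiv (pderiv P)) z" for z
  define f where "f z = of_real (bump R (p z)) * cnj (p' z) * c" for z
  define f' where "f' z v = of_real (bump_slope R (p z) * (p z \<bullet> (p' z * v))) * cnj (p' z) * c
      + of_real (bump R (p z)) * cnj (p'' z * v) * c" for z v
  have cont: "continuous_on UNIV p" "continuous_on UNIV p'" "continuous_on UNIV p''"
    unfolding p_p'_p''_def by (intro continuous_intros)+
  have K: "compact {z. norm (poly P z) \<le> 2 * R + norm b}" by (rule compact_poly_sublevel[OF P])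
  have off: "f z = 0" if "z \<notin> {z. norm (poly P z) \<le> 2 * R + norm b}" for z
    using smoothed_area_support[OF R, of P z b] that by (auto simp: f_def p_p'_p''_def)
  have der: "(f has_derivative f' z) (at z)" for z
  proof -
    have "((\<lambda>z. bump R (p z)) has_derivative (\<lambda>v. bump_slope R (p z) * (p z \<bullet> (p' z * v)))) (at z)"
    proof (rule has_derivative_compose[OF _ has_derivative_bump])
      show "(p has_derivative (\<lambda>v. p' z * v)) (at z)"
        unfolding p_p'_p''_def by (rule has_derivative_eq_rhs, (rule derivative_intros)+) simp
    qed
    moreover have "((\<lambda>z. cnj (p' z)) has_derivative (\<lambda>v. cnj (p'' z * v))) (at z)"
    proof (rule bounded_linear.has_derivative[OF bounded_linear_cnj])
      show "(p' has_derivative (\<lambda>v. p'' z * v)) (at z)"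
        unfolding p_p'_p''_def by (rule has_derivative_eq_rhs, (rule derivative_intros)+) simp
    qed
    ultimately show ?thesis
      unfolding f_def f'_def
      by (intro has_derivative_eq_rhs[OF has_derivative_mult_left[OF has_derivative_mult[OF has_derivative_of_real]]])
        (auto simp: algebra_simps)
  qed
  have contf': "continuous_on UNIV (\<lambda>z. f' z v)" for v
    unfolding f'_def by (intro continuous_intros cont)
  have f'_off: "f' z v = 0" if "z \<notin> {z. norm (poly P z) \<le> 2 * R + norm b}" for z v
    by (rule has_derivative_zero_off_support[OF compact_imp_closed[OF K] off that der])
  have int: "integrable lborel (\<lambda>z. f' z v)" for v
    by (rule integrable_continuous_compact_support[OF contf' K f'_off])
  have zero: "(LINT z|lborel. f' z v) = 0" for v
    by (rule integral_directional_derivative_eq_0[OF der contf' K off])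
  \<comment> \<open>In complex notation the divergence of a field with derivative \<open>f'\<close> is \<open>Re (f' 1 - \<i> f' \<i>)\<close>.\<close>
  have "bump_slope R (p z) * (p z \<bullet> c) * (norm (p' z))\<^sup>2 = Re (f' z 1 - \<i> * f' z \<i>)" for z
  proof -
    have "complex_of_real (p z \<bullet> p' z) - \<i> * complex_of_real (p z \<bullet> (p' z * \<i>)) = cnj (p z) * p' z"
      by (simp add: complex_eq_iff inner_complex_def)
    then have "of_real (bump_slope R (p z)) * cnj (p' z) * c * (complex_of_real (p z \<bullet> p' z) - \<i> * complex_of_real (p z \<bullet> (p' z * \<i>)))
      = of_real (bump_slope R (p z)) * cnj (p' z) * c * (cnj (p z) * p' z)" by (simp only:)
    moreover have "f' z 1 - \<i> * f' z \<i> =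
        of_real (bump_slope R (p z)) * cnj (p' z) * c * (complex_of_real (p z \<bullet> p' z) - \<i> * complex_of_real (p z \<bullet> (p' z * \<i>)))"
      by (simp add: f'_def algebra_simps)
    ultimately have "f' z 1 - \<i> * f' z \<i> = of_real (bump_slope R (p z)) * (p' z * cnj (p' z)) * (c * cnj (p z))"
      by (simp add: mult_ac)
    also have "\<dots> = of_real (bump_slope R (p z) * (norm (p' z))\<^sup>2) * (c * cnj (p z))"
      by (simp only: complex_norm_square of_real_mult)
    also have "Re \<dots> = bump_slope R (p z) * (norm (p' z))\<^sup>2 * (p z \<bullet> c)"
      by (simp add: inner_complex_def)
    finally show ?thesis by simp
  qed
  then have "(LINT z|lborel. bump_slope R (p z) * (p z \<bullet> c) * (norm (p' z))\<^sup>2) = (LINT z|lborel. Re (f' z 1 - \<i> * f' z \<i>))"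
    by simp
  also have "\<dots> = Re ((LINT z|lborel. f' z 1) - \<i> * (LINT z|lborel. f' z \<i>))"
    using int by simp
  also have "\<dots> = 0" by (simp add: zero)
  finally show ?thesis by (simp add: p_p'_p''_def)
qed

text \<open>Moving the centre along the segment from \<open>0\<close> to \<open>c\<close>, the derivative is the integral that was just shown to
  vanish.\<close>

lemma smoothed_area_constant:
  assumes P: "degree P > 0" and R: "R \<ge> 0"
  shows "smoothed_area P R c = smoothed_area P R 0"
proof -
  let ?w = "\<lambda>s z. poly P z - of_real s * c" and ?q = "\<lambda>z. (norm (poly (pderiv P) z))\<^sup>2"
  let ?K = "{z. norm (poly P z) \<le> 2 * R + norm c}"
  have K: "compact ?K" by (rule compact_poly_sublevel[OF P])
  obtain a where a: "?K \<subseteq> cbox (- a) a"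
    using bounded_subset_cbox_symmetric[OF compact_imp_bounded[OF K]] by blast
  have box: "integral (cbox (- a) a) g = (LINT z|lborel. g z)"
    if g: "continuous_on UNIV g" "\<And>z. z \<notin> ?K \<Longrightarrow> g z = 0" for g :: "complex \<Rightarrow> real"
  proof -
    have "(\<lambda>z. if z \<in> cbox (- a) a then g z else 0) = g"
    proof (rule ext)
      fix z
      show "(if z \<in> cbox (- a) a then g z else 0) = g z"
        using subsetD[OF a, of z] g(2)[of z] by auto
    qed
    then have "integral (cbox (- a) a) g = integral UNIV g"
      using integral_restrict_UNIV[of "cbox (- a) a" g] by simp
    also have "\<dots> = (LINT z|lborel. g z)"
      by (rule integral_lborel integrable_continuous_compact_support[OF g(1) K g(2)])+
    finally show ?thesis .
  qed
  \<comment> \<open>All bumps along the segment are supported in the same compact set.\<close>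
  have w_off: "norm (?w s z) > 2 * R" if "z \<notin> ?K" "s \<in> {0..1}" for s z
  proof -
    have "norm (of_real s * c) \<le> norm c"
      using that(2) by (auto simp: norm_mult intro: mult_left_le_one_le)
    moreover have "norm (poly P z) \<le> norm (?w s z) + norm (of_real s * c)"
      using norm_triangle_ineq[of "?w s z" "of_real s * c"] by simp
    ultimately show ?thesis using that(1) by auto
  qed
  define h where "h s = integral (cbox (- a) a) (\<lambda>z. bump R (?w s z) * ?q z)" for s
  have h: "h s = smoothed_area P R (of_real s * c)" if s: "s \<in> {0..1}" for s
    unfolding h_def smoothed_area_def
  proof (rule box)
    show "continuous_on UNIV (\<lambda>z. bump R (?w s z) * ?q z)" by (intro continuous_intros)
    show "bump R (?w s z) * ?q z = 0" if "z \<notin> ?K" for z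
      using bump_zero[of R "?w s z"] w_off[OF that s] R by simp
  qed
  have hd: "(h has_vector_derivative integral (cbox (- a) a) (\<lambda>z. bump_slope R (?w s z) * (?w s z \<bullet> (- c)) * ?q z)) (at s within {0..1})"
    if s: "s \<in> {0..1}" for s
    unfolding h_def
  proof (rule leibniz_rule_vector_derivative[where fx = "\<lambda>s z. bump_slope R (?w s z) * (?w s z \<bullet> (- c)) * ?q z"])
    fix s z
    have "((\<lambda>s. bump R (?w s z)) has_derivative (\<lambda>t. bump_slope R (?w s z) * (?w s z \<bullet> (- (of_real t * c))))) (at s within {0..1})"
      by (rule has_derivative_compose[OF _ has_derivative_bump])
        (rule has_derivative_eq_rhs, (rule derivative_intros)+, simp)
    from has_derivative_mult_left[OF this, of "?q z"]
    show "((\<lambda>s. bump R (?w s z) * ?q z) has_vector_derivative bump_slope R (?w s z) * (?w s z \<bullet> (- c)) * ?q z) (at s within {0..1})"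
      unfolding has_vector_derivative_def
      by (rule has_derivative_eq_rhs) (auto simp: scaleR_conv_of_real[where 'a = complex, symmetric])
    show "(\<lambda>z. bump R (?w s z) * ?q z) integrable_on cbox (- a) a"
      by (intro integrable_continuous continuous_intros)
    show "continuous_on ({0..1} \<times> cbox (- a) a) (\<lambda>(s, z). bump_slope R (?w s z) * (?w s z \<bullet> (- c)) * ?q z)"
      unfolding case_prod_unfold by (intro continuous_intros)
  qed (use s in auto)
  have hz: "integral (cbox (- a) a) (\<lambda>z. bump_slope R (?w s z) * (?w s z \<bullet> (- c)) * ?q z) = 0"
    if s: "s \<in> {0..1}" for s
  proof -
    have "integral (cbox (- a) a) (\<lambda>z. bump_slope R (?w s z) * (?w s z \<bullet> (- c)) * ?q z)
        = (LINT z|lborel. bump_slope R (?w s z) * (?w s z \<bullet> (- c)) * ?q z)"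
    proof (rule box)
      show "continuous_on UNIV (\<lambda>z. bump_slope R (?w s z) * (?w s z \<bullet> (- c)) * ?q z)" by (intro continuous_intros)
      show "bump_slope R (?w s z) * (?w s z \<bullet> (- c)) * ?q z = 0" if "z \<notin> ?K" for z
      proof -
        have "bump R (?w s z) = 0" using bump_zero[of R "?w s z"] w_off[OF that s] R by simp
        then have "bump_slope R (?w s z) = 0" by (simp add: bump_def bump_slope_def)
        then show ?thesis by simp
      qed
    qed
    then show ?thesis using integral_bump_slope_eq_0[OF P R] by simp
  qed
  have "(h has_vector_derivative 0) (at s within {0..1})" if "s \<in> {0..1}" for s
    using hd[OF that] unfolding hz[OF that] .
  then have "h 1 = h 0"
    by (intro has_derivative_zero_unique[of "{0..1}" h 1 0]) (auto simp: has_vector_derivative_def)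
  then show ?thesis using h[of 0] h[of 1] by simp
qed

text \<open>On \<open>\<bar>P\<bar> \<le> 2 R\<close> the variable is at most \<open>L\<close> with \<open>L ^ d\<close> of the order of \<open>R\<close>; the derivative is at most of
  the order of \<open>L ^ (d - 1)\<close> there and the area of the disc is of the order of \<open>L\<^sup>2\<close>.\<close>

lemma smoothed_area_bound:
  assumes P: "degree P > 0"
  shows "\<exists>C>0. \<forall>R\<ge>1. \<forall>c. smoothed_area P R c \<le> C * R ^ 6"
proof -
  define d where "d = degree P"
  obtain K where K: "K > 0" "\<And>z. (1 + norm z) ^ d \<le> K * (1 + norm (poly P z))"
    using power_le_poly_norm[of P] P unfolding d_def by fastforce
  have "degree (pderiv P) \<le> d - 1" by (simp add: degree_pderiv d_def)
  then obtain K1 where K1: "K1 > 0" "\<And>z. norm (poly (pderiv P) z) \<le> K1 * (1 + norm z) ^ (d - 1)"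
    using poly_norm_le_power by blast
  have "smoothed_area P R c \<le> (16 * K1\<^sup>2 * pi * (3 * K)\<^sup>2) * R ^ 6" if R: "R \<ge> 1" for R c
  proof -
    define L where "L = root d (3 * K * R)"
    have d: "d > 0" using P by (simp add: d_def)
    have L: "L > 0" "L ^ d = 3 * K * R" using K(1) R d by (auto simp: L_def)
    have in_disc: "1 + norm z \<le> L" if "norm (poly P z) \<le> 2 * R" for z
    proof -
      have "(1 + norm z) ^ d \<le> K * (1 + norm (poly P z))" by (rule K(2))
      also have "\<dots> \<le> K * (3 * R)" using K(1) R that by (intro mult_left_mono) auto
      finally have "(1 + norm z) ^ d \<le> L ^ d" by (simp add: L(2) mult_ac)
      then show ?thesis using L(1) d by (simp add: power_mono_iff)
    qed
    let ?M = "16 * R ^ 4 * (K1 * L ^ (d - 1))\<^sup>2"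
    have "smoothed_area P R c = smoothed_area P R 0" using R by (intro smoothed_area_constant[OF P]) simp
    also have "\<dots> \<le> (LINT z|lborel. ?M * indicator (cball (0::complex) L) z)"
      unfolding smoothed_area_def
    proof (rule integral_mono)
      show "integrable lborel (\<lambda>z. bump R (poly P z - 0) * (norm (poly (pderiv P) z))\<^sup>2)"
        using smoothed_area_integrable[OF P, of R 0] R by simp
      show "integrable lborel (\<lambda>z. ?M * indicator (cball (0::complex) L) z)"
        using emeasure_lborel_cball_finite[of "0 :: complex" L]
        by (intro integrable_mult_right integrable_real_indicator) simp_all
      fix z
      show "bump R (poly P z - 0) * (norm (poly (pderiv P) z))\<^sup>2 \<le> ?M * indicator (cball 0 L) z"
      proof (cases "norm (poly P z) \<le> 2 * R")
        case True
        have z: "1 + norm z \<le> L" by (rule in_disc[OF True])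
        have "norm (poly (pderiv P) z) \<le> K1 * (1 + norm z) ^ (d - 1)" by (rule K1(2))
        also have "\<dots> \<le> K1 * L ^ (d - 1)" using K1(1) z by (intro mult_left_mono power_mono) auto
        finally have "(norm (poly (pderiv P) z))\<^sup>2 \<le> (K1 * L ^ (d - 1))\<^sup>2" by (intro power_mono) auto
        then have "bump R (poly P z - 0) * (norm (poly (pderiv P) z))\<^sup>2 \<le> ?M"
          by (intro mult_mono bump_le) auto
        then show ?thesis using z by simp
      next
        case False
        then have "bump R (poly P z) = 0" using R by (intro bump_zero) auto
        then show ?thesis by simp
      qed
    qed
    also have "\<dots> = ?M * (pi * L\<^sup>2)"
      using L(1) by (simp add: content_cball unit_ball_vol_2)
    also have "\<dots> = 16 * R ^ 4 * K1\<^sup>2 * pi * (L ^ (d - 1) * L)\<^sup>2"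
      by (simp add: power_mult_distrib)
    also have "L ^ (d - 1) * L = 3 * K * R" using L(2) d by (metis power_minus_mult)
    also have "16 * R ^ 4 * K1\<^sup>2 * pi * (3 * K * R)\<^sup>2 = (16 * K1\<^sup>2 * pi * (3 * K)\<^sup>2) * R ^ 6"
      by (simp add: power_mult_distrib flip: power_add)
    finally show ?thesis .
  qed
  then show ?thesis using K(1) K1(1) by (intro exI[of _ "16 * K1\<^sup>2 * pi * (3 * K)\<^sup>2"]) auto
qed

lemma preimage_area_bound:
  fixes P :: "complex poly"
  shows "\<exists>C>0. \<forall>R\<ge>1. \<forall>c. (\<integral>\<^sup>+z. ennreal ((norm (poly (pderiv P) z))\<^sup>2) * indicator {z. norm (poly P z - c) < R} z \<partial>lborel)
      \<le> ennreal (C * R\<^sup>2)"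
proof (cases "degree P > 0")
  case False
  then have "pderiv P = 0" by (simp add: pderiv_eq_0_iff)
  then show ?thesis by (intro exI[of _ 1]) simp
next
  case True
  obtain C where C: "C > 0" "\<And>R c. R \<ge> 1 \<Longrightarrow> smoothed_area P R c \<le> C * R ^ 6"
    using smoothed_area_bound[OF True] by blast
  have "(\<integral>\<^sup>+z. ennreal ((norm (poly (pderiv P) z))\<^sup>2) * indicator {z. norm (poly P z - c) < R} z \<partial>lborel)
      \<le> ennreal (C * R\<^sup>2)" if R: "R \<ge> 1" for R c
  proof -
    let ?q = "\<lambda>z. (norm (poly (pderiv P) z))\<^sup>2"
    have "(\<integral>\<^sup>+z. ennreal (?q z) * indicator {z. norm (poly P z - c) < R} z \<partial>lborel)
        \<le> (\<integral>\<^sup>+z. ennreal (bump R (poly P z - c) * ?q z / R ^ 4) \<partial>lborel)"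
    proof (rule nn_integral_mono)
      fix z
      have "?q z * R ^ 4 \<le> bump R (poly P z - c) * ?q z" if "norm (poly P z - c) < R"
        using mult_right_mono[OF bump_ge[OF that], of "?q z"] by (simp add: mult.commute)
      then show "ennreal (?q z) * indicator {z. norm (poly P z - c) < R} z
          \<le> ennreal (bump R (poly P z - c) * ?q z / R ^ 4)"
        using R by (auto simp: indicator_def field_simps intro!: ennreal_leI)
    qed
    also have "\<dots> = ennreal (LINT z|lborel. bump R (poly P z - c) * ?q z / R ^ 4)"
      using smoothed_area_integrable[OF True, of R c] R
      by (intro nn_integral_eq_integral) auto
    also have "(LINT z|lborel. bump R (poly P z - c) * ?q z / R ^ 4) = smoothed_area P R c / R ^ 4"
      by (simp add: smoothed_area_def)
    also have "ennreal \<dots> \<le> ennreal (C * R\<^sup>2)"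
    proof (rule ennreal_leI)
      have "smoothed_area P R c / R ^ 4 \<le> C * R ^ 6 / R ^ 4"
        using C(2)[OF R] R by (intro divide_right_mono) auto
      also have "C * R ^ 6 / R ^ 4 = C * R\<^sup>2"
      proof -
        have "R ^ 6 = R\<^sup>2 * R ^ 4" by (simp flip: power_add)
        then have "C * R ^ 6 / R ^ 4 = (C * R\<^sup>2) * R ^ 4 / R ^ 4" by (simp only: mult.assoc)
        also have "\<dots> = C * R\<^sup>2" by (rule nonzero_mult_div_cancel_right) (use R in simp)
        finally show ?thesis .
      qed
      finally show "smoothed_area P R c / R ^ 4 \<le> C * R\<^sup>2" .
    qed
    finally show ?thesis .
  qed
  then show ?thesis using C(1) by blast
qed

text \<open>The projections of the graph to the two coordinate axes have bounded multiplicity, so that its area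
  in a ball is controlled by the areas of two discs.\<close>

lemma graph_area_bound:
  fixes P :: "complex poly"
  shows "\<exists>C>0. \<forall>r\<ge>1. \<forall>x. (\<integral>\<^sup>+z. ennreal (1 + (norm (poly (pderiv P) z))\<^sup>2) * indicator (ball (graph_point P z) r) x \<partial>lborel)
      \<le> ennreal (C * r\<^sup>2)"
proof -
  obtain C where C: "C > 0" "\<And>R c. R \<ge> 1 \<Longrightarrow>
      (\<integral>\<^sup>+z. ennreal ((norm (poly (pderiv P) z))\<^sup>2) * indicator {z. norm (poly P z - c) < R} z \<partial>lborel) \<le> ennreal (C * R\<^sup>2)"
    using preimage_area_bound[of P] by blast
  have "(\<integral>\<^sup>+z. ennreal (1 + (norm (poly (pderiv P) z))\<^sup>2) * indicator (ball (graph_point P z) r) x \<partial>lborel)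
      \<le> ennreal ((pi + C) * r\<^sup>2)" if r: "r \<ge> 1" for r and x :: "complex ^ 2"
  proof -
    let ?q = "\<lambda>z. (norm (poly (pderiv P) z))\<^sup>2"
    have [measurable]: "(\<lambda>z. poly Q z) \<in> borel_measurable borel" for Q :: "complex poly"
      by (intro borel_measurable_continuous_onI continuous_intros)
    have "(\<integral>\<^sup>+z. ennreal (1 + ?q z) * indicator (ball (graph_point P z) r) x \<partial>lborel)
        \<le> (\<integral>\<^sup>+z. indicator (ball (x $ 1) r) z + ennreal (?q z) * indicator {z. norm (poly P z - x $ 2) < r} z \<partial>lborel)"
    proof (rule nn_integral_mono)
      fix z
      have "norm (z - x $ 1) \<le> norm (graph_point P z - x)" "norm (poly P z - x $ 2) \<le> norm (graph_point P z - x)"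
        using Finite_Cartesian_Product.norm_nth_le[of "graph_point P z - x" 1]
          Finite_Cartesian_Product.norm_nth_le[of "graph_point P z - x" 2] by simp_all
      then show "ennreal (1 + ?q z) * indicator (ball (graph_point P z) r) x
          \<le> indicator (ball (x $ 1) r) z + ennreal (?q z) * indicator {z. norm (poly P z - x $ 2) < r} z"
        by (auto simp: indicator_def dist_norm norm_minus_commute)
    qed
    also have "\<dots> = emeasure lborel (ball (x $ 1) r)
        + (\<integral>\<^sup>+z. ennreal (?q z) * indicator {z. norm (poly P z - x $ 2) < r} z \<partial>lborel)"
      by (subst nn_integral_add) (auto intro!: borel_measurable_indicator)
    also have "\<dots> \<le> ennreal (pi * r\<^sup>2) + ennreal (C * r\<^sup>2)"
      using r by (intro add_mono C(2)) (simp_all add: emeasure_ball unit_ball_vol_2)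
    also have "\<dots> = ennreal ((pi + C) * r\<^sup>2)"
      using C(1) by (subst ennreal_plus[symmetric]) (auto simp: distrib_right)
    finally show ?thesis .
  qed
  then show ?thesis using C(1) by (intro exI[of _ "pi + C"]) (auto intro: add_pos_pos)
qed

section \<open>The averaged current is small compared with the Gaussian form\<close>

abbreviation ball_average :: "real \<Rightarrow> form11 \<Rightarrow> form11" where
  "ball_average r \<beta> \<equiv> \<lambda>z. LINT w|lborel. ball_kernel r w *\<^sub>R \<beta> (z + w)"

lemma ball_kernel_nonneg [simp]: "ball_kernel r w \<ge> 0"
  by (simp add: ball_kernel_def)

lemma ball_average_zero:
  assumes "\<And>w. norm w < r \<Longrightarrow> \<beta> (z + w) = 0"
  shows "ball_average r \<beta> z = 0"
proof -
  have "ball_kernel r w *\<^sub>R \<beta> (z + w) = 0" for w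
    using assms[of w] by (cases "norm w < r") (auto simp: ball_kernel_def)
  then show ?thesis by (simp only: Bochner_Integration.integral_zero)
qed

lemma continuous_on_ball_average:
  fixes \<beta> :: form11
  assumes \<beta>: "continuous_on UNIV \<beta>" and B: "\<And>p. norm (\<beta> p) \<le> B"
  shows "continuous_on UNIV (ball_average r \<beta>)"
  unfolding continuous_on_sequentially
proof (intro allI ballI impI, elim conjE)
  fix x :: "nat \<Rightarrow> complex ^ 2" and a
  assume x: "x \<longlonglongrightarrow> a"
  have int: "integrable lborel (\<lambda>w. ball_kernel r w *\<^sub>R \<beta> (z + w))" for z
    by (intro integrable_ball_kernel_scaleR continuous_on_compose2[OF \<beta>] continuous_intros) auto
  have "(\<lambda>n. ball_average r \<beta> (x n)) \<longlonglongrightarrow> ball_average r \<beta> a"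
  proof (rule integral_dominated_convergence)
    show "integrable lborel (\<lambda>w. ball_kernel r (w :: complex ^ 2) *\<^sub>R B)"
      by (intro integrable_ball_kernel_scaleR continuous_intros)
    show "AE w in lborel. (\<lambda>n. ball_kernel r w *\<^sub>R \<beta> (x n + w)) \<longlonglongrightarrow> ball_kernel r w *\<^sub>R \<beta> (a + w)"
    proof (intro always_eventually allI tendsto_scaleR tendsto_const)
      fix w
      have "isCont \<beta> (a + w)" using \<beta> by (simp add: continuous_on_eq_continuous_at)
      then show "(\<lambda>n. \<beta> (x n + w)) \<longlonglongrightarrow> \<beta> (a + w)"
        by (rule isCont_tendsto_compose) (intro tendsto_intros x)
    qed
    show "AE w in lborel. norm (ball_kernel r w *\<^sub>R \<beta> (x n + w)) \<le> ball_kernel r w *\<^sub>R B" for n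
      by (intro always_eventually allI) (simp add: B mult_left_mono)
  qed (use borel_measurable_integrable[OF int] in auto)
  then show "(ball_average r \<beta> \<circ> x) \<longlonglongrightarrow> ball_average r \<beta> a" by (simp add: comp_def)
qed

lemma compact_support_ball_average:
  fixes \<beta> :: form11
  assumes "compact (closure {p. \<beta> p \<noteq> 0})"
  shows "compact (closure {p. ball_average r \<beta> p \<noteq> 0})"
proof -
  obtain R where R: "\<And>p. \<beta> p \<noteq> 0 \<Longrightarrow> norm p \<le> R"
    using compact_imp_bounded[OF assms] closure_subset[of "{p. \<beta> p \<noteq> 0}"]
    unfolding bounded_iff by blast
  have "norm p \<le> R + r" if p: "ball_average r \<beta> p \<noteq> 0" for p
  proof -
    obtain w where w: "norm w < r" "\<beta> (p + w) \<noteq> 0" using ball_average_zero p by blast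
    have "norm p \<le> norm (p + w) + norm w" using norm_triangle_ineq4[of "p + w" w] by simp
    then show ?thesis using R[OF w(2)] w(1) by simp
  qed
  then have "bounded {p. ball_average r \<beta> p \<noteq> 0}" unfolding bounded_iff by blast
  then show ?thesis by simp
qed

definition hermitian_value :: "complex ^ 2 ^ 2 \<Rightarrow> complex ^ 2 \<Rightarrow> complex" where
  "hermitian_value M u = (\<Sum>j\<in>UNIV. \<Sum>k\<in>UNIV. M $ j $ k * u $ j * cnj (u $ k))"

text \<open>The values at \<open>u\<close> and at the orthogonal vector \<open>(- cnj u\<^sub>2, cnj u\<^sub>1)\<close> of the same length add up to \<open>\<bar>u\<bar>\<^sup>2\<close> times the
  trace, and neither is negative.\<close>

lemma positive_form_trace:
  assumes "positive_form \<beta>"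
  defines "\<tau> \<equiv> \<lambda>p. Re (\<beta> p $ 1 $ 1 + \<beta> p $ 2 $ 2)"
  shows "\<beta> p $ 1 $ 1 + \<beta> p $ 2 $ 2 = of_real (\<tau> p)"
    and "\<tau> p \<ge> 0"
    and "hermitian_value (\<beta> p) u = of_real (Re (hermitian_value (\<beta> p) u))"
    and "0 \<le> Re (hermitian_value (\<beta> p) u)"
    and "Re (hermitian_value (\<beta> p) u) \<le> (norm u)\<^sup>2 * \<tau> p"
proof -
  have pos: "0 \<le> Re (hermitian_value (\<beta> p) u)" "Im (hermitian_value (\<beta> p) u) = 0" for u
    using assms(1) unfolding positive_form_def hermitian_value_def complex_nonneg_Reals_iff by blast+
  show "hermitian_value (\<beta> p) u = of_real (Re (hermitian_value (\<beta> p) u))"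
    using pos(2) by (simp add: complex_eq_iff)
  show "0 \<le> Re (hermitian_value (\<beta> p) u)" by (rule pos)
  have *: "hermitian_value (\<beta> p) (vec2 1 0) = \<beta> p $ 1 $ 1" "hermitian_value (\<beta> p) (vec2 0 1) = \<beta> p $ 2 $ 2"
    by (simp_all add: hermitian_value_def sum_2)
  show tr: "\<beta> p $ 1 $ 1 + \<beta> p $ 2 $ 2 = of_real (\<tau> p)"
    using pos(2)[of "vec2 1 0"] pos(2)[of "vec2 0 1"] by (simp add: * \<tau>_def complex_eq_iff)
  show "\<tau> p \<ge> 0"
    using pos(1)[of "vec2 1 0"] pos(1)[of "vec2 0 1"] by (simp add: * \<tau>_def)
  have "hermitian_value (\<beta> p) u + hermitian_value (\<beta> p) (vec2 (- cnj (u $ 2)) (cnj (u $ 1)))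
      = (u $ 1 * cnj (u $ 1) + u $ 2 * cnj (u $ 2)) * (\<beta> p $ 1 $ 1 + \<beta> p $ 2 $ 2)"
    by (simp add: hermitian_value_def sum_2 algebra_simps)
  also have "\<dots> = of_real ((norm u)\<^sup>2 * \<tau> p)"
    by (simp only: tr norm_vec2_sq of_real_mult of_real_add complex_norm_square)
  finally have "Re (hermitian_value (\<beta> p) u) + Re (hermitian_value (\<beta> p) (vec2 (- cnj (u $ 2)) (cnj (u $ 1))))
      = (norm u)\<^sup>2 * \<tau> p" by (metis Re_complex_of_real plus_complex.sel(1))
  then show "Re (hermitian_value (\<beta> p) u) \<le> (norm u)\<^sup>2 * \<tau> p" using pos(1) by (metis le_add_same_cancel1)
qed

lemma graph_density_eq_hermitian_value:
  "graph_density P \<beta> z = 2 * hermitian_value (\<beta> (graph_point P z)) (vec2 1 (poly (pderiv P) z))"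
  by (simp add: graph_density_def hermitian_value_def)

lemma bounded_linear_hermitian_value: "bounded_linear (\<lambda>M. 2 * hermitian_value M u)"
  unfolding linear_conv_bounded_linear[symmetric]
  by (rule linearI) (simp_all add: hermitian_value_def sum_2 scaleR_conv_of_real[where 'a = complex] algebra_simps)

lemma nn_integral_lborel_translation:
  fixes f :: "'a::euclidean_space \<Rightarrow> ennreal"
  assumes [measurable]: "f \<in> borel_measurable borel"
  shows "(\<integral>\<^sup>+x. f (c + x) \<partial>lborel) = (\<integral>\<^sup>+x. f x \<partial>lborel)"
proof -
  have "(\<integral>\<^sup>+x. f x \<partial>lborel) = (\<integral>\<^sup>+x. f x \<partial>distr lborel borel ((+) c))"
    by (simp add: lborel_distr_plus)
  also have "\<dots> = (\<integral>\<^sup>+x. f (c + x) \<partial>lborel)" by (rule nn_integral_distr) auto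
  finally show ?thesis by simp
qed

text \<open>By Tonelli's theorem the mass of the averaged current against \<open>\<beta>\<close> is controlled by the trace of \<open>\<beta>\<close>
  times the largest area of the graph in a ball of radius \<open>r\<close>, divided by the volume of that ball.\<close>

lemma averaged_graph_current_bound:
  assumes \<beta>: "test_form \<beta>" "positive_form \<beta>"
    and area: "\<And>x. (\<integral>\<^sup>+z. ennreal (1 + (norm (poly (pderiv P) z))\<^sup>2) * indicator (ball (graph_point P z) r) x \<partial>lborel)
      \<le> ennreal A" and A: "A \<ge> 0"
  shows "\<exists>I. convolve_current (integration_current (poly_graph P)) (ball_kernel r) \<beta> = of_real I \<and>
     I \<le> 2 * A / measure lborel (ball (0 :: complex ^ 2) r) * (LINT p|lborel. Re (\<beta> p $ 1 $ 1 + \<beta> p $ 2 $ 2))"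
proof -
  let ?\<tau> = "\<lambda>p. Re (\<beta> p $ 1 $ 1 + \<beta> p $ 2 $ 2)" and ?V = "measure lborel (ball (0 :: complex ^ 2) r)"
  let ?v = "\<lambda>z. vec2 1 (poly (pderiv P) z)" and ?h = "\<lambda>z. 1 + (norm (poly (pderiv P) z))\<^sup>2"
  note tr = positive_form_trace[OF \<beta>(2)]
  have cont: "continuous_on UNIV \<beta>" and K: "compact (closure {p. \<beta> p \<noteq> 0})"
    using \<beta>(1) Ck_on_imp_continuous_on[of 0] unfolding test_form_def smooth_on_open_def by blast+
  have off: "\<beta> p = 0" if "p \<notin> closure {p. \<beta> p \<noteq> 0}" for p
    using that closure_subset[of "{p. \<beta> p \<noteq> 0}"] by blast
  have cont_\<tau>: "continuous_on UNIV ?\<tau>" by (intro continuous_intros cont)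
  have meas_\<tau>: "(\<lambda>p. ennreal (?\<tau> p)) \<in> borel_measurable borel"
    by (rule measurable_compose[OF borel_measurable_continuous_onI[OF cont_\<tau>] measurable_ennreal])
  have off_\<tau>: "?\<tau> p = 0" if "p \<notin> closure {p. \<beta> p \<noteq> 0}" for p
    unfolding off[OF that] by simp
  have int_\<tau>: "integrable lborel ?\<tau>"
    by (rule integrable_continuous_compact_support[OF cont_\<tau> K off_\<tau>])
  obtain B where B: "\<And>p. norm (\<beta> p) \<le> B"
  proof -
    have "bounded (\<beta> ` closure {p. \<beta> p \<noteq> 0})"
      by (intro compact_imp_bounded compact_continuous_image continuous_on_subset[OF cont] K) simp
    then obtain B where B: "\<And>p. p \<in> closure {p. \<beta> p \<noteq> 0} \<Longrightarrow> norm (\<beta> p) \<le> B"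
      unfolding bounded_iff by blast
    have "norm (\<beta> p) \<le> max 0 B" for p
    proof (cases "p \<in> closure {p. \<beta> p \<noteq> 0}")
      case True
      then show ?thesis using B[OF True] by (rule_tac max.coboundedI2)
    next
      case False
      show ?thesis unfolding off[OF False] by simp
    qed
    then show ?thesis by (rule that)
  qed
  define D where "D z = graph_density P (ball_average r \<beta>) z" for z
  note avg = continuous_on_ball_average[OF cont B, of r] compact_support_ball_average[OF K, of r]
  have current: "convolve_current (integration_current (poly_graph P)) (ball_kernel r) \<beta> = (LINT z|lborel. D z)"
    unfolding convolve_current_def D_def by (rule integration_current_poly_graph[OF avg])
  have int_D: "integrable lborel D"
    unfolding D_def
  proof (rule integrable_graph_density(1)[OF avg])
    fix p assume p: "p \<in> poly_graph P - closure {p. ball_average r \<beta> p \<noteq> 0}"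
    show "ball_average r \<beta> p = 0"
      using p closure_subset[of "{p. ball_average r \<beta> p \<noteq> 0}"] by blast
  qed
  have D_eq: "D z = of_real (Re (D z))" and D_nonneg: "0 \<le> Re (D z)"
    and D_le: "ennreal (Re (D z)) \<le> (\<integral>\<^sup>+x. ennreal (2 * ?h z / ?V) * indicator (ball (graph_point P z) r) x * ennreal (?\<tau> x) \<partial>lborel)" for z
  proof -
    let ?q = "\<lambda>w. hermitian_value (\<beta> (graph_point P z + w)) (?v z)"
    have cont_shift: "continuous_on UNIV (\<lambda>w. \<beta> (graph_point P z + w))"
      by (intro continuous_on_compose2[OF cont] continuous_intros) auto
    have int: "integrable lborel (\<lambda>w. ball_kernel r w *\<^sub>R \<beta> (graph_point P z + w))"
      by (intro integrable_ball_kernel_scaleR cont_shift)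
    have "D z = (LINT w|lborel. 2 * hermitian_value (ball_kernel r w *\<^sub>R \<beta> (graph_point P z + w)) (?v z))"
      unfolding D_def graph_density_eq_hermitian_value
      by (rule integral_bounded_linear[OF bounded_linear_hermitian_value int, symmetric])
    also have "\<dots> = (LINT w|lborel. of_real (ball_kernel r w * (2 * Re (?q w))))"
    proof (rule Bochner_Integration.integral_cong[OF refl])
      fix w
      have "2 * hermitian_value (ball_kernel r w *\<^sub>R \<beta> (graph_point P z + w)) (?v z) = of_real (ball_kernel r w) * (2 * ?q w)"
        using linear_scale[OF bounded_linear.linear[OF bounded_linear_hermitian_value[of "?v z"]]]
        by (simp only: scaleR_conv_of_real[where 'a = complex])
      also have "\<dots> = of_real (ball_kernel r w * (2 * Re (?q w)))"
        by (subst tr(3)) simp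
      finally show "2 * hermitian_value (ball_kernel r w *\<^sub>R \<beta> (graph_point P z + w)) (?v z)
          = of_real (ball_kernel r w * (2 * Re (?q w)))" .
    qed
    also have "\<dots> = of_real (LINT w|lborel. ball_kernel r w * (2 * Re (?q w)))"
      by (rule integral_complex_of_real)
    finally have D: "D z = of_real (LINT w|lborel. ball_kernel r w * (2 * Re (?q w)))" .
    then show "D z = of_real (Re (D z))" by simp
    have nonneg: "0 \<le> ball_kernel r w * (2 * Re (?q w))" for w
      by (intro mult_nonneg_nonneg tr(4) ball_kernel_nonneg) simp
    show "0 \<le> Re (D z)" unfolding D using nonneg by simp
    have "continuous_on UNIV (\<lambda>w. 2 * Re (?q w))"
      unfolding hermitian_value_def sum_2 by (intro continuous_intros cont_shift)
    from integrable_ball_kernel_scaleR[OF this, of r]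
    have int_q: "integrable lborel (\<lambda>w. ball_kernel r w * (2 * Re (?q w)))" by simp
    have "ennreal (Re (D z)) = (\<integral>\<^sup>+w. ennreal (ball_kernel r w * (2 * Re (?q w))) \<partial>lborel)"
      unfolding D Re_complex_of_real using int_q nonneg by (intro nn_integral_eq_integral[symmetric]) auto
    also have "\<dots> \<le> (\<integral>\<^sup>+w. ennreal (2 * ?h z / ?V) * indicator (ball (graph_point P z) r) (graph_point P z + w)
        * ennreal (?\<tau> (graph_point P z + w)) \<partial>lborel)"
    proof (rule nn_integral_mono)
      fix w
      have norm_v: "(norm (?v z))\<^sup>2 = ?h z" by (simp add: norm_vec2_sq)
      show "ennreal (ball_kernel r w * (2 * Re (?q w))) \<le> ennreal (2 * ?h z / ?V) *
          indicator (ball (graph_point P z) r) (graph_point P z + w) * ennreal (?\<tau> (graph_point P z + w))"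
      proof (cases "norm w < r")
        case True
        have "ball_kernel r w * (2 * Re (?q w)) \<le> 1 / ?V * (2 * (?h z * ?\<tau> (graph_point P z + w)))"
          using True tr(5)[of "graph_point P z + w" "?v z"] unfolding norm_v ball_kernel_def
          by (intro mult_mono) (auto simp: tr(4))
        also have "\<dots> = 2 * ?h z / ?V * ?\<tau> (graph_point P z + w)" by simp
        finally have "ennreal (ball_kernel r w * (2 * Re (?q w))) \<le> ennreal (2 * ?h z / ?V * ?\<tau> (graph_point P z + w))"
          by (rule ennreal_leI)
        also have "\<dots> = ennreal (2 * ?h z / ?V) * ennreal (?\<tau> (graph_point P z + w))"
          by (rule ennreal_mult) (use tr(2) in auto)
        finally show ?thesis using True by (simp add: dist_norm)
      qed (simp add: ball_kernel_def)
    qed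
    also have "\<dots> = (\<integral>\<^sup>+x. ennreal (2 * ?h z / ?V) * indicator (ball (graph_point P z) r) x * ennreal (?\<tau> x) \<partial>lborel)"
      by (rule nn_integral_lborel_translation[of "\<lambda>x. ennreal (2 * ?h z / ?V) * indicator (ball (graph_point P z) r) x * ennreal (?\<tau> x)"])
        (intro borel_measurable_times_ennreal borel_measurable_const borel_measurable_indicator meas_\<tau> borel_open open_ball)
    finally show "ennreal (Re (D z)) \<le> \<dots>" .
  qed
  have int_Re: "integrable lborel (\<lambda>z. Re (D z))" using int_D by simp
  have "ennreal (LINT z|lborel. Re (D z)) = (\<integral>\<^sup>+z. ennreal (Re (D z)) \<partial>lborel)"
    using D_nonneg by (intro nn_integral_eq_integral[symmetric] int_Re) auto
  also have "\<dots> \<le> (\<integral>\<^sup>+z. \<integral>\<^sup>+x. ennreal (2 * ?h z / ?V) * indicator (ball (graph_point P z) r) x * ennreal (?\<tau> x) \<partial>lborel \<partial>lborel)"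
    by (intro nn_integral_mono D_le)
  also have "\<dots> = (\<integral>\<^sup>+x. \<integral>\<^sup>+z. ennreal (2 * ?h z / ?V) * indicator (ball (graph_point P z) r) x * ennreal (?\<tau> x) \<partial>lborel \<partial>lborel)"
  proof -
    let ?O = "{p :: complex \<times> (complex ^ 2). dist (graph_point P (fst p)) (snd p) < r}"
    have h: "(\<lambda>z. ennreal (2 * ?h z / ?V)) \<in> borel_measurable borel"
      by (intro measurable_compose[OF _ measurable_ennreal] borel_measurable_divide borel_measurable_const
          borel_measurable_continuous_onI continuous_intros)
    have "open ?O" by (intro open_Collect_less continuous_intros)
    then have O: "?O \<in> sets (borel \<Otimes>\<^sub>M borel)" unfolding borel_prod by (rule borel_open)
    have "(\<lambda>(z, x). ennreal (2 * ?h z / ?V) * indicator ?O (z, x) * ennreal (?\<tau> x))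
        = (\<lambda>p. ennreal (2 * ?h (fst p) / ?V) * indicator ?O p * ennreal (?\<tau> (snd p)))"
      by auto
    moreover have "\<dots> \<in> borel_measurable (borel \<Otimes>\<^sub>M borel)"
      by (intro borel_measurable_times_ennreal borel_measurable_indicator O
          measurable_compose[OF measurable_fst h] measurable_compose[OF measurable_snd meas_\<tau>])
    ultimately have "(\<lambda>(z, x). ennreal (2 * ?h z / ?V) * indicator ?O (z, x) * ennreal (?\<tau> x))
        \<in> borel_measurable (lborel \<Otimes>\<^sub>M lborel)"
      by (simp only: measurable_cong_sets[OF sets_pair_measure_cong[OF sets_lborel sets_lborel] refl])
    from pair_sigma_finite.Fubini'[OF pair_sigma_finite.intro[OF sigma_finite_lborel sigma_finite_lborel] this] show ?thesis by (simp add: indicator_def)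
  qed
  also have "\<dots> \<le> (\<integral>\<^sup>+x. ennreal (2 * A / ?V * ?\<tau> x) \<partial>lborel)"
  proof (rule nn_integral_mono)
    fix x :: "complex ^ 2"
    have [measurable]: "?h \<in> borel_measurable borel"
      by (intro borel_measurable_continuous_onI continuous_intros)
    have "open {z. dist (graph_point P z) x < r}" by (intro open_Collect_less continuous_intros)
    then have [measurable]: "{z. dist (graph_point P z) x < r} \<in> sets borel" by simp
    have ind: "indicator (ball (graph_point P z) r) x = (indicator {z. dist (graph_point P z) x < r} z :: ennreal)" for z
      by (simp add: indicator_def)
    have regroup: "ennreal (2 * h / V) * ennreal t = ennreal (2 / V * t) * ennreal h"
      if "h \<ge> 0" "V \<ge> 0" "t \<ge> 0" for h V t :: real
      using that by (simp add: mult_ac flip: ennreal_mult)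
    have "(\<integral>\<^sup>+z. ennreal (2 * ?h z / ?V) * indicator (ball (graph_point P z) r) x * ennreal (?\<tau> x) \<partial>lborel)
        = (\<integral>\<^sup>+z. ennreal (2 / ?V * ?\<tau> x) * (ennreal (?h z) * indicator (ball (graph_point P z) r) x) \<partial>lborel)"
    proof (rule nn_integral_cong)
      fix z
      have "ennreal (2 * ?h z / ?V) * ennreal (?\<tau> x) = ennreal (2 / ?V * ?\<tau> x) * ennreal (?h z)"
        by (rule regroup) (use tr(2) in auto)
      then show "ennreal (2 * ?h z / ?V) * indicator (ball (graph_point P z) r) x * ennreal (?\<tau> x)
          = ennreal (2 / ?V * ?\<tau> x) * (ennreal (?h z) * indicator (ball (graph_point P z) r) x)"
        by (simp add: indicator_def)
    qed
    also have "\<dots> = ennreal (2 / ?V * ?\<tau> x) * (\<integral>\<^sup>+z. ennreal (?h z) * indicator (ball (graph_point P z) r) x \<partial>lborel)"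
      unfolding ind by (rule nn_integral_cmult) measurable
    also have "\<dots> \<le> ennreal (2 / ?V * ?\<tau> x) * ennreal A" by (intro mult_left_mono area) simp
    also have "\<dots> = ennreal (2 * A / ?V * ?\<tau> x)"
      by (subst regroup[symmetric]) (use tr(2)[of x] A in \<open>auto simp flip: ennreal_mult\<close>)
    finally show "(\<integral>\<^sup>+z. ennreal (2 * ?h z / ?V) * indicator (ball (graph_point P z) r) x * ennreal (?\<tau> x) \<partial>lborel)
        \<le> ennreal (2 * A / ?V * ?\<tau> x)" .
  qed
  also have "\<dots> = ennreal (LINT x|lborel. 2 * A / ?V * ?\<tau> x)"
  proof (rule nn_integral_eq_integral)
    show "integrable lborel (\<lambda>x. 2 * A / ?V * ?\<tau> x)" by (rule integrable_mult_right) (rule int_\<tau>)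
    show "AE x in lborel. 0 \<le> 2 * A / ?V * ?\<tau> x"
      by (intro always_eventually allI mult_nonneg_nonneg divide_nonneg_nonneg A tr(2)) auto
  qed
  also have "(LINT x|lborel. 2 * A / ?V * ?\<tau> x) = 2 * A / ?V * (LINT x|lborel. ?\<tau> x)"
    by (rule integral_mult_right_zero)
  finally have "(LINT z|lborel. Re (D z)) \<le> 2 * A / ?V * (LINT x|lborel. ?\<tau> x)"
    by (subst (asm) ennreal_le_iff) (intro mult_nonneg_nonneg divide_nonneg_nonneg A integral_nonneg_AE always_eventually allI tr(2), auto)
  moreover have "(LINT z|lborel. D z) = of_real (LINT z|lborel. Re (D z))"
    by (subst D_eq) (rule integral_complex_of_real)
  ultimately show ?thesis using current by (intro exI[of _ "LINT z|lborel. Re (D z)"]) simp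
qed

section \<open>Upper density of a polynomial graph\<close>

lemma eventually_positive_current:
  assumes a: "a > 0"
  shows "\<forall>\<^sub>F r in at_top. positive_current (\<lambda>\<beta>.
        complex_of_real (1 / (2 * pi)) * i_ddbar (convolve_fun (\<lambda>p. (norm p)\<^sup>2) (ball_kernel r)) \<beta>
        - complex_of_real (1 / a) * convolve_current (integration_current (poly_graph P)) (ball_kernel r) \<beta>)"
proof -
  obtain C where C: "C > 0" "\<And>r x. r \<ge> 1 \<Longrightarrow>
      (\<integral>\<^sup>+z. ennreal (1 + (norm (poly (pderiv P) z))\<^sup>2) * indicator (ball (graph_point P z) r) x \<partial>lborel) \<le> ennreal (C * r\<^sup>2)"
    using graph_area_bound[of P] by blast
  define c where "c = unit_ball_vol 4"
  have c: "c > 0" by (simp add: c_def)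
  have "positive_current (\<lambda>\<beta>.
        complex_of_real (1 / (2 * pi)) * i_ddbar (convolve_fun (\<lambda>p. (norm p)\<^sup>2) (ball_kernel r)) \<beta>
        - complex_of_real (1 / a) * convolve_current (integration_current (poly_graph P)) (ball_kernel r) \<beta>)"
    \<comment> \<open>With the volume \<open>c r\<^sup>4\<close> of the ball, this makes \<open>2 C r\<^sup>2 / (a c r\<^sup>4)\<close> at most \<open>2 / \<pi>\<close>.\<close>
    if r: "r \<ge> max 1 (pi * C / (a * c))" for r
    unfolding positive_current_def
  proof (intro allI impI, elim conjE)
    fix \<beta> assume \<beta>: "test_form \<beta>" "positive_form \<beta>"
    let ?\<tau> = "\<lambda>p. Re (\<beta> p $ 1 $ 1 + \<beta> p $ 2 $ 2)" and ?V = "measure lborel (ball (0 :: complex ^ 2) r)"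
    define T where "T = (LINT p|lborel. ?\<tau> p)"
    note tr = positive_form_trace[OF \<beta>(2)]
    have T: "T \<ge> 0" unfolding T_def by (intro integral_nonneg_AE always_eventually allI tr(2))
    have r1: "r \<ge> 1" using r by simp
    obtain I where I: "convolve_current (integration_current (poly_graph P)) (ball_kernel r) \<beta> = of_real I"
      "I \<le> 2 * (C * r\<^sup>2) / ?V * T"
      using averaged_graph_current_bound[OF \<beta> C(2)[OF r1]] C(1) unfolding T_def by auto
    have V: "?V = c * r ^ 4" using r1 by (simp add: content_ball c_def)
    have "pi * C \<le> a * c * r" using r a c by (simp add: pos_divide_le_eq mult.commute)
    also have "\<dots> \<le> a * c * r\<^sup>2" using a c r1 by (simp add: power2_eq_square)
    finally have "pi * C * r\<^sup>2 \<le> a * c * r\<^sup>2 * r\<^sup>2" by (rule mult_right_mono) simp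
    then have "C * r\<^sup>2 / ?V \<le> a / pi"
      using c r1 unfolding V by (simp add: field_simps flip: power_add)
    then have "2 * (C * r\<^sup>2) / ?V * T \<le> 2 * (a / pi) * T"
      using T by (intro mult_right_mono) auto
    with I(2) have "I \<le> 2 * (a / pi) * T" by linarith
    then have "1 / a * I \<le> 1 / a * (2 * (a / pi) * T)" using a by (intro mult_left_mono) auto
    also have "\<dots> = 1 / (2 * pi) * (4 * T)" using a by (simp add: field_simps)
    finally have le: "1 / a * I \<le> 1 / (2 * pi) * (4 * T)" .
    have "i_ddbar (convolve_fun (\<lambda>p. (norm p)\<^sup>2) (ball_kernel r)) \<beta> = 4 * (LINT p|lborel. \<beta> p $ 1 $ 1 + \<beta> p $ 2 $ 2)"
      using r1 by (intro i_ddbar_convolve_norm_sq \<beta>) simp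
    also have "(LINT p|lborel. \<beta> p $ 1 $ 1 + \<beta> p $ 2 $ 2) = (LINT p|lborel. complex_of_real (?\<tau> p))"
      by (rule Bochner_Integration.integral_cong[OF refl tr(1)])
    also have "4 * \<dots> = of_real (4 * T)" unfolding T_def by (simp only: integral_complex_of_real of_real_mult of_real_numeral)
    finally have G: "i_ddbar (convolve_fun (\<lambda>p. (norm p)\<^sup>2) (ball_kernel r)) \<beta> = of_real (4 * T)" .
    have "complex_of_real (1 / (2 * pi)) * of_real (4 * T) - complex_of_real (1 / a) * of_real I
        = of_real (1 / (2 * pi) * (4 * T) - 1 / a * I)"
      by (simp only: of_real_diff of_real_mult)
    also have "\<dots> \<in> \<real>\<^sub>\<ge>\<^sub>0" using le by (simp only: nonneg_Reals_of_real_iff diff_ge_0_iff_ge)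
    finally show "complex_of_real (1 / (2 * pi)) * i_ddbar (convolve_fun (\<lambda>p. (norm p)\<^sup>2) (ball_kernel r)) \<beta>
        - complex_of_real (1 / a) * convolve_current (integration_current (poly_graph P)) (ball_kernel r) \<beta> \<in> \<real>\<^sub>\<ge>\<^sub>0"
      unfolding G I(1) .
  qed
  then show ?thesis by (rule eventually_at_top_linorderI)
qed

lemma upper_density_poly_graph: "upper_density (\<lambda>p. (norm p)\<^sup>2) (poly_graph P) = 0"
proof (rule antisym)
  show "upper_density (\<lambda>p. (norm p)\<^sup>2) (poly_graph P) \<le> 0"
  proof (rule ereal_le_epsilon2)
    fix a :: real assume a: "0 < a"
    have "real_of_ereal (1 / ereal a) = 1 / a" using a by (simp add: one_ereal_def)
    then have "upper_density (\<lambda>p. (norm p)\<^sup>2) (poly_graph P) \<le> ereal a"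
      unfolding upper_density_def using eventually_positive_current[OF a, of P] a
      by (intro Inf_lower) simp
    then show "upper_density (\<lambda>p. (norm p)\<^sup>2) (poly_graph P) \<le> 0 + ereal a" by simp
  qed
  show "0 \<le> upper_density (\<lambda>p. (norm p)\<^sup>2) (poly_graph P)"
    unfolding upper_density_def by (intro Inf_greatest) auto
qed

theorem theorem1p1:
  fixes P :: "complex poly"
  shows "algebraic_curve (poly_graph P) \<and> uniformly_flat (poly_graph P) \<and>
         upper_density (\<lambda>p. (norm p)\<^sup>2) (poly_graph P) = 0"
  using algebraic_curve_poly_graph uniformly_flat_poly_graph upper_density_poly_graph by blast

end
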